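(* Let $\Delta t>0$, let $u_0\in U_h$ with $\operatorname{div}u_0=0$ and $\rho_0\in F_h$, and let $u_1,u_2,\ldots\in U_h$, $\rho_1,\rho_2,\ldots\in F_h$, $p_1,p_2,\ldots\in Q_h$ satisfy, for every $k\ge 0$ and every $(v,\sigma,q)\in U_h\times F_h\times Q_h$, $$\sum_{e \in \mathcal{E}_h} \int_e \alpha_e(u_{k+1/2}) (n \times \llbracket (\rho u)_{k+1/2} \rrbracket ) \cdot \llbracket u_{k+1/2} \times v \rrbracket \, ds + \sum_{e \in \mathcal{E}_h} \int_e \frac{\beta_e(u_{k+1/2})}{2|u_{k+1/2} \cdot n|^2} (u_{k+1/2} \cdot n)(v \cdot n) \llbracket \overline{u_k \cdot u_{k+1}} \rrbracket \cdot \llbracket \rho_{k+1/2} \rrbracket \, ds$$ $$+ \left\langle \frac{ \rho_{k+1} u_{k+1}-\rho_k u_k }{ \Delta t }, v \right\rangle + a_h( (\rho u)_{k+1/2}, u_{k+1/2}, v ) - \frac{1}{2}b_h\left( v, \overline{ u_k \cdot u_{k+1} }, \rho_{k+1/2} \right) - \langle p_{k+1}, \operatorname{div} v \rangle = 0,$$ $$\left\langle \frac{\rho_{k+1}-\rho_k}{\Delta t}, \sigma \right\rangle - b_h( u_{k+1/2}, \sigma, \rho_{k+1/2} ) + \sum_{e \in \mathcal{E}_h} \int_e \beta_e(u_{k+1/2}) \llbracket \sigma \rrbracket \cdot \llbracket \rho_{k+1/2} \rrbracket \, ds = 0,$$ $$\langle \operatorname{div} u_{k+1}, q \rangle = 0,$$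 where $u_{k+1/2}=\frac{u_k+u_{k+1}}{2}$, $\rho_{k+1/2}=\frac{\rho_k+\rho_{k+1}}{2}$ and $(\rho u)_{k+1/2}=\frac{\rho_ku_k+\rho_{k+1}u_{k+1}}{2}$. Then, for every $k$, $\operatorname{div}u_k\equiv 0$ on $\Omega$.
   Context: Let $n\in\{2,3\}$ be the dimension and $\Omega\subset\mathbb{R}^n$ a bounded domain with a triangulation $\mathcal{T}_h$ into simplices; $\mathcal{E}_h$ is the set of interior $(n-1)$-dimensional faces. (The symbol $n$ also denotes unit normal vectors.) $P_r(K)$ is the space of polynomials of degree at most $r$ on $K$. Let $H_0(\operatorname{div},\Omega)=\{u\in L^2(\Omega)^n \mid \operatorname{div}u\in L^2(\Omega),\ u\cdot n=0 \text{ on }\partial\Omega\}$. Fix integers $s,m\ge 0$ and set: - $RT_s(\mathcal{T}_h)=\{u\in H_0(\operatorname{div},\Omega)\mid u|_K\in P_s(K)^n+xP_s(K)\ \forall K\in\mathcal{T}_h\}$; - $BDM_{s+1}(\mathcal{T}_h)=\{u\in H_0(\operatorname{div},\Omega)\mid u|_K\in P_{s+1}(K)^n\ \forall K\in\mathcal{T}_h\}$; - $DG_r(\mathcal{T}_h)=\{f\in L^2(\Omega)\mid f|_K\in P_r(K)\ \forall K\in\mathcal{T}_h\}$; - $U_h\in\{RT_s(\mathcal{T}_h),BDM_{s+1}(\mathcal{T}_h)\}$, $F_h=DG_m(\mathcal{T}_h)$, $Q_h=DG_s(\mathcal{T}_h)$. $W_h$ is the space of vector fields on $\Omega$ that are piecewise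 smooth with respect to $\mathcal{T}_h$. $\langle\cdot,\cdot\rangle$ is the $L^2(\Omega)$ inner product (of scalar or vector fields). $\overline{f}\in F_h$ denotes the $L^2$-orthogonal projection of $f$ onto $F_h$. Jumps and averages on $e=K_1\cap K_2\in\mathcal{E}_h$: for scalar $f$ with $f_i=f|_{K_i}$, $\llbracket f\rrbracket=f_1n_1+f_2n_2$ and $\{f\}=\frac{f_1+f_2}{2}$, where $n_1$ is the unit normal to $e$ pointing from $K_1$ to $K_2$ and $n_2=-n_1$. For vector fields, fix a unit normal $n$ for each $e$, order $K_1,K_2$ so that $n$ points from $K_1$ to $K_2$, and set $\llbracket u\rrbracket=u_1-u_2$, $\{u\}=\frac{u_1+u_2}{2}$ (here subscripts $1,2$ denote restrictions to $K_1,K_2$); the jump $\llbracket u\times v\rrbracket$ is the difference of the values of $u\times v$ from $K_1$ and from $K_2$. In dimension 2, vectors are embedded in $\mathbb{R}^3$ with zero third component to form cross products. For $u\in U_h$, $u\cdot n$ is single-valued on $e$. Trilinear forms $a_h:W_h\times U_h\times U_h\to\mathbb{R}$ and $b_h:U_h\times F_h\times F_h\to\mathbb{R}$: $$a_h(w,u,v)=\sum_{K\in\mathcal{T}_h}\int_K w\cdot(v\cdot\nabla u-u\cdot\nabla v)\,dx+\sum_{e\in\mathcal{E}_h}\int_e(n\times\{w\})\cdot\llbracket u\times v\rrbracket\,ds,$$ $$b_h(u,f,g)=\sum_{K\in\mathcal{T}_h}\int_K(u\cdot\nabla f)g\,dx-\sum_{e\in\mathcal{E}_h}\int_e u\cdot\llbracket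 f\rrbracket\{g\}\,ds.$$ Parameters: for each $e\in\mathcal{E}_h$ and $u\in U_h$, $\alpha_e(u)$ and $\beta_e(u)$ are functions on $e$ that may depend on $u$, such that the integrals in the scheme are well defined. $\beta_e(u)\ge 0$; $\alpha_e(u)$ is either nonnegative or of the form $c_1\frac{u\cdot n}{|u\cdot n|}$ with $c_1\in[0,\frac12]$ (taken to be $0$ where $u\cdot n=0$). Where $u\cdot n=0$, $\beta_e(u)$ is assumed to vanish (as for the standard choice $\beta_e(u)=c_2|u\cdot n|$, $c_2\in[0,\frac12]$), and the coefficient $\frac{\beta_e(u)}{2|u\cdot n|^2}(u\cdot n)(v\cdot n)$ is taken to be $0$ there. *)

theory Defs
  imports "HOL-Analysis.Analysis"
begin

section \<open>Lebesgue and Sobolev spaces on a domain\<close>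

text \<open>
  Elements of function spaces over \<open>\<Omega>\<close> are represented by total functions on the ambient space;
  only their values on \<open>\<Omega>\<close> matter.
\<close>

definition square_integrable :: "('a::euclidean_space) set \<Rightarrow> ('a \<Rightarrow> 'b::euclidean_space) \<Rightarrow> bool"
  where "square_integrable \<Omega> f \<longleftrightarrow>
    f \<in> borel_measurable (lebesgue_on \<Omega>) \<and> integrable (lebesgue_on \<Omega>) (\<lambda>x. (norm (f x))\<^sup>2)"

definition L2_inner :: "('a::euclidean_space) set \<Rightarrow> ('a \<Rightarrow> 'b::euclidean_space) \<Rightarrow> ('a \<Rightarrow> 'b) \<Rightarrow> real"
  where "L2_inner \<Omega> f g = (LINT x|lebesgue_on \<Omega>. f x \<bullet> g x)"

definition grad :: "('a::euclidean_space \<Rightarrow> real) \<Rightarrow> 'a \<Rightarrow> 'a"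
  where "grad f x = (THE D. GDERIV f x :> D)"

text \<open>Test functions are the compactly supported \<open>C\<^sup>1\<close> functions on \<open>\<Omega>\<close>, extended by zero.\<close>

definition test_function :: "('a::euclidean_space) set \<Rightarrow> ('a \<Rightarrow> real) \<Rightarrow> bool"
  where "test_function \<Omega> \<phi> \<longleftrightarrow>
    (\<forall>x. \<phi> differentiable (at x)) \<and> continuous_on UNIV (grad \<phi>) \<and>
    compact (closure {x. \<phi> x \<noteq> 0}) \<and> closure {x. \<phi> x \<noteq> 0} \<subseteq> \<Omega>"

definition has_weak_grad :: "('a::euclidean_space) set \<Rightarrow> ('a \<Rightarrow> real) \<Rightarrow> ('a \<Rightarrow> 'a) \<Rightarrow> bool"
  where "has_weak_grad \<Omega> f G \<longleftrightarrow>
    (\<forall>\<phi>. test_function \<Omega> \<phi> \<longrightarrow>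
      (LINT x|lebesgue_on \<Omega>. f x *\<^sub>R grad \<phi> x) = - (LINT x|lebesgue_on \<Omega>. \<phi> x *\<^sub>R G x))"

definition has_weak_div :: "('a::euclidean_space) set \<Rightarrow> ('a \<Rightarrow> 'a) \<Rightarrow> ('a \<Rightarrow> real) \<Rightarrow> bool"
  where "has_weak_div \<Omega> u d \<longleftrightarrow>
    (\<forall>\<phi>. test_function \<Omega> \<phi> \<longrightarrow> L2_inner \<Omega> u (grad \<phi>) = - L2_inner \<Omega> d \<phi>)"

text \<open>Some representative of the weak divergence in \<open>L\<^sup>2(\<Omega>)\<close>, which is unique up to null sets.\<close>

definition divergence :: "('a::euclidean_space) set \<Rightarrow> ('a \<Rightarrow> 'a) \<Rightarrow> 'a \<Rightarrow> real"
  where "divergence \<Omega> u = (SOME d. square_integrable \<Omega> d \<and> has_weak_div \<Omega> u d)"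

text \<open>
  The normal trace of \<open>u \<in> H(div, \<Omega>)\<close> is the functional that sends the boundary values of
  \<open>f \<in> H\<^sup>1(\<Omega>)\<close> to \<open>\<langle>u, \<nabla>f\<rangle> + \<langle>div u, f\<rangle>\<close>.  The condition \<open>u \<cdot> n = 0\<close> on \<open>\<partial>\<Omega>\<close> says that it vanishes.
\<close>

definition zero_normal_trace :: "('a::euclidean_space) set \<Rightarrow> ('a \<Rightarrow> 'a) \<Rightarrow> bool"
  where "zero_normal_trace \<Omega> u \<longleftrightarrow>
    (\<forall>f G. square_integrable \<Omega> f \<and> square_integrable \<Omega> G \<and> has_weak_grad \<Omega> f G \<longrightarrow>
      L2_inner \<Omega> u G + L2_inner \<Omega> (divergence \<Omega> u) f = 0)"

definition H0_div :: "('a::euclidean_space) set \<Rightarrow> ('a \<Rightarrow> 'a) set"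
  where "H0_div \<Omega> = {u. square_integrable \<Omega> u \<and>
    (\<exists>d. square_integrable \<Omega> d \<and> has_weak_div \<Omega> u d) \<and> zero_normal_trace \<Omega> u}"

section \<open>Meshes\<close>

text \<open>
  The library's notion of triangulation already requires finiteness and that two simplices meet
  in a common (possibly empty) face.
\<close>

definition mesh_of :: "('a::euclidean_space) set \<Rightarrow> 'a set set \<Rightarrow> bool"
  where "mesh_of \<Omega> T \<longleftrightarrow>
    triangulation T \<and> (\<forall>K\<in>T. int DIM('a) simplex K) \<and>
    \<Union>T = closure \<Omega> \<and> (\<forall>K\<in>T. interior K \<subseteq> \<Omega>)"

definition interior_faces :: "('a::euclidean_space) set \<Rightarrow> 'a set set \<Rightarrow> 'a set set"
  where "interior_faces \<Omega> T =
    {e. (\<exists>K1\<in>T. \<exists>K2\<in>T. K1 \<noteq> K2 \<and> e = K1 \<inter> K2) \<and>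
        aff_dim e = int DIM('a) - 1 \<and> rel_interior e \<subseteq> \<Omega>}"

definition unit_normal :: "('a::euclidean_space) set \<Rightarrow> 'a \<Rightarrow> bool"
  where "unit_normal e n \<longleftrightarrow> norm n = 1 \<and> (\<forall>x\<in>e. \<forall>y\<in>e. n \<bullet> (x - y) = 0)"

text \<open>
  The element with face \<open>e\<close> for which \<open>n\<close> is the outer normal.  If \<open>n\<close> points from
  \<open>K\<^sub>1\<close> to \<open>K\<^sub>2\<close>, then \<open>K\<^sub>1 = element_behind T n e\<close> and \<open>K\<^sub>2 = element_behind T (- n) e\<close>.
\<close>

definition element_behind :: "('a::euclidean_space) set set \<Rightarrow> 'a \<Rightarrow> 'a set \<Rightarrow> 'a set"
  where "element_behind T n e =
    (THE K. K \<in> T \<and> e face_of K \<and> (\<forall>x\<in>K. \<forall>y\<in>e. n \<bullet> (x - y) \<le> 0))"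

text \<open>
  Surface integrals over a flat face \<open>e\<close> with unit normal \<open>n\<close>: in orthonormal coordinates adapted to
  \<open>e\<close> the prism over \<open>e\<close> of height 1 is a product, and the integrand, being constant along
  \<open>n\<close>, has the same integral over the prism as \<open>f\<close> has over \<open>e\<close>.  On the prism,
  \<open>closest_point e\<close> is the orthogonal projection to \<open>e\<close>.
\<close>

definition prism :: "('a::euclidean_space) \<Rightarrow> 'a set \<Rightarrow> 'a set"
  where "prism n e = {y + t *\<^sub>R n | y t. y \<in> e \<and> 0 \<le> t \<and> t \<le> 1}"

definition face_integrable :: "('a::euclidean_space) \<Rightarrow> 'a set \<Rightarrow> ('a \<Rightarrow> real) \<Rightarrow> bool"
  where "face_integrable n e f \<longleftrightarrow>
    integrable (lebesgue_on (prism n e)) (\<lambda>x. f (closest_point e x))"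

definition face_integral :: "('a::euclidean_space) \<Rightarrow> 'a set \<Rightarrow> ('a \<Rightarrow> real) \<Rightarrow> real"
  where "face_integral n e f = (LINT x|lebesgue_on (prism n e). f (closest_point e x))"

section \<open>Finite element spaces\<close>

definition polys :: "nat \<Rightarrow> (real^'n \<Rightarrow> real) set"
  where "polys r = {p. \<exists>c :: ('n \<Rightarrow> nat) \<Rightarrow> real.
    \<forall>x. p x = (\<Sum>a | sum a UNIV \<le> r. c a * (\<Prod>i\<in>UNIV. (x $ i) ^ a i))}"

text \<open>
  The piecewise conditions are imposed on the interiors of the elements, because an \<open>L\<^sup>2\<close> function has
  no well-defined values on the faces; values from either side are recovered below as limits.
\<close>

definition DG :: "(real^'n) set \<Rightarrow> (real^'n) set set \<Rightarrow> nat \<Rightarrow> (real^'n \<Rightarrow> real) set"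
  where "DG \<Omega> T r = {f. square_integrable \<Omega> f \<and>
    (\<forall>K\<in>T. \<exists>p\<in>polys r. \<forall>x\<in>interior K. f x = p x)}"

definition RT :: "(real^'n) set \<Rightarrow> (real^'n) set set \<Rightarrow> nat \<Rightarrow> (real^'n \<Rightarrow> real^'n) set"
  where "RT \<Omega> T s = {u \<in> H0_div \<Omega>.
    \<forall>K\<in>T. \<exists>p. (\<forall>i. p i \<in> polys s) \<and> (\<exists>q\<in>polys s.
      \<forall>x\<in>interior K. u x = (\<chi> i. p i x) + q x *\<^sub>R x)}"

definition BDM :: "(real^'n) set \<Rightarrow> (real^'n) set set \<Rightarrow> nat \<Rightarrow> (real^'n \<Rightarrow> real^'n) set"
  where "BDM \<Omega> T r = {u \<in> H0_div \<Omega>.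
    \<forall>K\<in>T. \<exists>p. (\<forall>i. p i \<in> polys r) \<and> (\<forall>x\<in>interior K. u x = (\<chi> i. p i x))}"

definition L2_proj ::
    "('a::euclidean_space) set \<Rightarrow> ('a \<Rightarrow> real) set \<Rightarrow> ('a \<Rightarrow> real) \<Rightarrow> 'a \<Rightarrow> real"
  where "L2_proj \<Omega> F f =
    (SOME g. g \<in> F \<and> (\<forall>h\<in>F. L2_inner \<Omega> (\<lambda>x. f x - g x) h = 0))"

section \<open>Traces, jumps and averages\<close>

definition trace1 ::
    "('a::euclidean_space) set set \<Rightarrow> 'a \<Rightarrow> 'a set \<Rightarrow> ('a \<Rightarrow> 'b::euclidean_space) \<Rightarrow> 'a \<Rightarrow> 'b"
  where "trace1 T n e f x = Lim (at x within interior (element_behind T n e)) f"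

definition trace2 ::
    "('a::euclidean_space) set set \<Rightarrow> 'a \<Rightarrow> 'a set \<Rightarrow> ('a \<Rightarrow> 'b::euclidean_space) \<Rightarrow> 'a \<Rightarrow> 'b"
  where "trace2 T n e f x = Lim (at x within interior (element_behind T (- n) e)) f"

definition scalar_jump :: "('a::euclidean_space) set set \<Rightarrow> 'a \<Rightarrow> 'a set \<Rightarrow> ('a \<Rightarrow> real) \<Rightarrow> 'a \<Rightarrow> 'a"
  where "scalar_jump T n e f x = trace1 T n e f x *\<^sub>R n + trace2 T n e f x *\<^sub>R (- n)"

definition vector_jump ::
    "('a::euclidean_space) set set \<Rightarrow> 'a \<Rightarrow> 'a set \<Rightarrow> ('a \<Rightarrow> 'b::euclidean_space) \<Rightarrow> 'a \<Rightarrow> 'b"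
  where "vector_jump T n e u x = trace1 T n e u x - trace2 T n e u x"

definition average ::
    "('a::euclidean_space) set set \<Rightarrow> 'a \<Rightarrow> 'a set \<Rightarrow> ('a \<Rightarrow> 'b::euclidean_space) \<Rightarrow> 'a \<Rightarrow> 'b"
  where "average T n e f x = (1/2) *\<^sub>R (trace1 T n e f x + trace2 T n e f x)"

text \<open>For fields in \<open>H(div)\<close> the normal component is single-valued, so one side suffices.\<close>

definition normal_comp :: "('a::euclidean_space) set set \<Rightarrow> 'a \<Rightarrow> 'a set \<Rightarrow> ('a \<Rightarrow> 'a) \<Rightarrow> 'a \<Rightarrow> real"
  where "normal_comp T n e u x = trace1 T n e u x \<bullet> n"

text \<open>
  Dimensions 2 and 3 are treated uniformly through an index type \<open>'n\<close> with 2 or 3 elements.  The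
  class \<open>comm_ring_1\<close> only serves to make the numerals 1, 2, 3 available as indices; by cardinality
  they exhaust \<open>'n\<close>.  The numeral types 2 and 3 are instances.
\<close>

type_synonym 'n rvec = "(real, 'n) vec"

definition embed3 :: "('n::{finite,comm_ring_1}) rvec \<Rightarrow> real^3"
  where "embed3 x = (if CARD('n) = 2 then vector [x $ 1, x $ 2, 0] else vector [x $ 1, x $ 2, x $ 3])"

lemma embed3_dim2: "embed3 (x :: real^2) = vector [x $ 1, x $ 2, 0]"
  by (simp add: embed3_def)

lemma embed3_dim3: "embed3 (x :: real^3) = x"
  by (simp add: embed3_def vec_eq_iff forall_3)

definition cross :: "('n::{finite,comm_ring_1}) rvec \<Rightarrow> 'n rvec \<Rightarrow> real^3"
  where "cross x y = cross3 (embed3 x) (embed3 y)"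

section \<open>The forms of the scheme\<close>

text \<open>
  The argument \<open>\<nu>\<close> assigns to each interior face its fixed unit normal.  The field
  \<open>v \<cdot> \<nabla>u\<close> is the derivative of \<open>u\<close> in direction \<open>v\<close>.
\<close>

definition a_form ::
    "('n::{finite,comm_ring_1}) rvec set \<Rightarrow> 'n rvec set set \<Rightarrow> ('n rvec set \<Rightarrow> 'n rvec) \<Rightarrow>
     ('n rvec \<Rightarrow> 'n rvec) \<Rightarrow> ('n rvec \<Rightarrow> 'n rvec) \<Rightarrow> ('n rvec \<Rightarrow> 'n rvec) \<Rightarrow> real"
  where "a_form \<Omega> T \<nu> w u v =
    (\<Sum>K\<in>T. LINT x|lebesgue_on (interior K).
       w x \<bullet> (frechet_derivative u (at x) (v x) - frechet_derivative v (at x) (u x))) +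
    (\<Sum>e\<in>interior_faces \<Omega> T. face_integral (\<nu> e) e (\<lambda>x.
       cross (\<nu> e) (average T (\<nu> e) e w x) \<bullet> vector_jump T (\<nu> e) e (\<lambda>y. cross (u y) (v y)) x))"

definition b_form ::
    "(real^'n) set \<Rightarrow> (real^'n) set set \<Rightarrow> ((real^'n) set \<Rightarrow> real^'n) \<Rightarrow>
     (real^'n \<Rightarrow> real^'n) \<Rightarrow> (real^'n \<Rightarrow> real) \<Rightarrow> (real^'n \<Rightarrow> real) \<Rightarrow> real"
  where "b_form \<Omega> T \<nu> u f g =
    (\<Sum>K\<in>T. LINT x|lebesgue_on (interior K). (u x \<bullet> grad f x) * g x) -
    (\<Sum>e\<in>interior_faces \<Omega> T. face_integral (\<nu> e) e (\<lambda>x.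
       (trace1 T (\<nu> e) e u x \<bullet> scalar_jump T (\<nu> e) e f x) * average T (\<nu> e) e g x))"

text \<open>
  In \<open>b_form\<close> only the single-valued normal component of \<open>u\<close> enters the face terms, because
  the jump of a scalar is normal to the face.

  The integrands of the stabilization terms follow.  Since \<open>x / 0 = 0\<close>, the coefficient in
  \<open>momentum_beta_term\<close> is 0 where \<open>u \<cdot> n = 0\<close>.
\<close>

definition momentum_alpha_term ::
    "('n::{finite,comm_ring_1}) rvec set set \<Rightarrow> 'n rvec \<Rightarrow> 'n rvec set \<Rightarrow> ('n rvec \<Rightarrow> real) \<Rightarrow>
     ('n rvec \<Rightarrow> 'n rvec) \<Rightarrow> ('n rvec \<Rightarrow> 'n rvec) \<Rightarrow> ('n rvec \<Rightarrow> 'n rvec) \<Rightarrow> 'n rvec \<Rightarrow> real"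
  where "momentum_alpha_term T n e \<alpha> w u v x =
    \<alpha> x * (cross n (vector_jump T n e w x) \<bullet> vector_jump T n e (\<lambda>y. cross (u y) (v y)) x)"

definition momentum_beta_term ::
    "(real^'n) set set \<Rightarrow> real^'n \<Rightarrow> (real^'n) set \<Rightarrow> (real^'n \<Rightarrow> real) \<Rightarrow>
     (real^'n \<Rightarrow> real^'n) \<Rightarrow> (real^'n \<Rightarrow> real^'n) \<Rightarrow> (real^'n \<Rightarrow> real) \<Rightarrow> (real^'n \<Rightarrow> real) \<Rightarrow>
     real^'n \<Rightarrow> real"
  where "momentum_beta_term T n e \<beta> u v f g x =
    \<beta> x / (2 * \<bar>normal_comp T n e u x\<bar>\<^sup>2) * normal_comp T n e u x * normal_comp T n e v x *
    (scalar_jump T n e f x \<bullet> scalar_jump T n e g x)"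

definition density_beta_term ::
    "(real^'n) set set \<Rightarrow> real^'n \<Rightarrow> (real^'n) set \<Rightarrow> (real^'n \<Rightarrow> real) \<Rightarrow>
     (real^'n \<Rightarrow> real) \<Rightarrow> (real^'n \<Rightarrow> real) \<Rightarrow> real^'n \<Rightarrow> real"
  where "density_beta_term T n e \<beta> f g x =
    \<beta> x * (scalar_jump T n e f x \<bullet> scalar_jump T n e g x)"

text \<open>The value at time level \<open>k + 1/2\<close>.\<close>

definition half_step :: "(nat \<Rightarrow> 'a \<Rightarrow> 'b::real_vector) \<Rightarrow> nat \<Rightarrow> 'a \<Rightarrow> 'b"
  where "half_step f k x = (1/2) *\<^sub>R (f k x + f (Suc k) x)"

end

theory Submission
  imports Defs
begin

text \<open>
  On the interior of each element \<open>u\<close> is a polynomial whose classical divergence has degree at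
  most \<open>s\<close>.  Testing the weak divergence with functions supported in the element shows that the two
  divergences agree almost everywhere, so the weak divergence has a representative in \<open>Q\<^sub>h\<close>.  The
  incompressibility equation may be tested with it, and the divergence has norm zero.
\<close>

text \<open>\<open>divergence\<close> picks an arbitrary representative of an L2 class, whereas
  \<open>DG\<close> asks for equality with a polynomial at every point of each open element. The
  chosen representative therefore need not be an admissible test function itself. A corrected copy,
  equal to it almost everywhere, has to be built, and every conclusion is of the almost-everywhere
  kind. That the two divergences agree inside an element is an instance of the fundamental lemma of
  the calculus of variations. Test functions are only required to be C1, so squared positive parts
  of quadratics can replace mollifiers: sums of such bumps approximate indicators of open sets, and
  inner regularity of Lebesgue measure leads from open sets to the merely measurable set where the
  difference is positive. Working strictly inside elements keeps faces and traces out of the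
  argument. Integration by parts there has no boundary term, since the product with a test function
  extends by zero and can be integrated over the whole space.\<close>

section \<open>Gradients and supports of test functions\<close>

lemma gderiv_unique:
  assumes "GDERIV f x :> D" "GDERIV f x :> E"
  shows "D = E"
proof -
  have "(\<lambda>h. h \<bullet> D) = (\<lambda>h. h \<bullet> E)"
    using assms unfolding gderiv_def by (rule has_derivative_unique)
  then have "(D - E) \<bullet> (D - E) = 0"
    by (metis inner_diff_right right_minus_eq)
  then show ?thesis by simp
qed

lemma grad_eq: "GDERIV f x :> D \<Longrightarrow> grad f x = D"
  unfolding grad_def by (intro the_equality) (auto dest: gderiv_unique)

text \<open>Riesz representation in finite dimension: a linear functional is the inner product with
  the vector of its values on the basis. Together with uniqueness this justifies the description
  operator in \<open>grad\<close> wherever the function is differentiable.\<close>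

lemma has_derivative_imp_gderiv:
  fixes f :: "'a::euclidean_space \<Rightarrow> real"
  assumes D: "(f has_derivative D) (at x)"
  shows "GDERIV f x :> (\<Sum>b\<in>Basis. D b *\<^sub>R b)"
proof -
  interpret D: bounded_linear D using D by (rule has_derivative_bounded_linear)
  have "D h = h \<bullet> (\<Sum>b\<in>Basis. D b *\<^sub>R b)" for h
  proof -
    have "D h = D (\<Sum>b\<in>Basis. (h \<bullet> b) *\<^sub>R b)" by (simp add: euclidean_representation)
    also have "\<dots> = h \<bullet> (\<Sum>b\<in>Basis. D b *\<^sub>R b)"
      by (simp add: D.sum D.scale inner_sum_right mult.commute)
    finally show ?thesis .
  qed
  then have "D = (\<lambda>h. h \<bullet> (\<Sum>b\<in>Basis. D b *\<^sub>R b))" by (rule ext)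
  with D show ?thesis unfolding gderiv_def by simp
qed

lemma test_functionI:
  fixes \<phi> :: "'a::euclidean_space \<Rightarrow> real"
  assumes G: "\<And>x. GDERIV \<phi> x :> G x" and "continuous_on UNIV G"
    and "bounded {x. \<phi> x \<noteq> 0}" "closure {x. \<phi> x \<noteq> 0} \<subseteq> V"
  shows "test_function V \<phi>"
proof -
  have "grad \<phi> = G" using grad_eq[OF G] by (rule ext)
  moreover have "\<phi> differentiable (at x)" for x
    using G[of x] unfolding gderiv_def by (rule differentiableI)
  ultimately show ?thesis
    using assms by (simp add: test_function_def compact_closure)
qed

lemma test_function_gderiv:
  assumes "test_function V \<phi>"
  shows "GDERIV \<phi> x :> grad \<phi> x"
proof -
  obtain D where "(\<phi> has_derivative D) (at x)"
    using assms unfolding test_function_def differentiable_def by blast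
  then have "GDERIV \<phi> x :> (\<Sum>b\<in>Basis. D b *\<^sub>R b)"
    by (rule has_derivative_imp_gderiv)
  then show ?thesis using grad_eq by metis
qed

text \<open>The complement of the closed support is open, so the function vanishes near each of its
  points and the gradient vanishes there as well.\<close>

lemma test_function_outside:
  assumes "test_function V \<phi>" "x \<notin> V"
  shows "\<phi> x = 0" "grad \<phi> x = 0"
proof -
  let ?S = "closure {x. \<phi> x \<noteq> 0}"
  have x: "x \<in> - ?S" using assms by (auto simp: test_function_def)
  have z: "0 = \<phi> y" if "y \<in> - ?S" for y
    using that closure_subset[of "{x. \<phi> x \<noteq> 0}"] by auto
  show "\<phi> x = 0" using z x by metis
  have "((\<lambda>_. 0 :: real) has_derivative (\<lambda>h. h \<bullet> 0)) (at x)" by simp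
  then have "(\<phi> has_derivative (\<lambda>h. h \<bullet> 0)) (at x)"
    by (rule has_derivative_transform_within_open[OF _ _ x z]) auto
  then show "grad \<phi> x = 0" by (intro grad_eq) (simp only: gderiv_def)
qed

lemma test_function_mono: "test_function V \<phi> \<Longrightarrow> V \<subseteq> W \<Longrightarrow> test_function W \<phi>"
  unfolding test_function_def by blast

section \<open>Test functions approximating the indicator of an open set\<close>

text \<open>Squaring removes the kink of the positive part. The derivative is continuous, which is
  exactly the regularity that test functions require.\<close>

lemma has_derivative_pos_part_square:
  "((\<lambda>t::real. (max 0 t)\<^sup>2) has_real_derivative 2 * max 0 t) (at t)"
proof -
  consider "t > 0" | "t < 0" | "t = 0" by linarith
  then show ?thesis
  proof cases
    case 1
    have "((\<lambda>t::real. t\<^sup>2) has_real_derivative 2 * t) (at t)"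
      by (auto intro!: derivative_eq_intros)
    then have "((\<lambda>t::real. (max 0 t)\<^sup>2) has_real_derivative 2 * t) (at t)"
      by (rule has_field_derivative_transform_within_open[where S = "{0<..}"]) (use 1 in auto)
    then show ?thesis using 1 by simp
  next
    case 2
    have "((\<lambda>t::real. 0) has_real_derivative 0) (at t)" by simp
    then have "((\<lambda>t::real. (max 0 t)\<^sup>2) has_real_derivative 0) (at t)"
      by (rule has_field_derivative_transform_within_open[where S = "{..<0}"]) (use 2 in auto)
    then show ?thesis using 2 by simp
  next
    case 3
    \<comment> \<open>At the junction the difference quotient is again the positive part; for h = 0
      this uses division by zero being 0.\<close>
    have "(\<lambda>h::real. (max 0 h)\<^sup>2 / h) = max 0"
      by (auto simp: fun_eq_iff max_def power2_eq_square)
    moreover have "(max 0 \<longlongrightarrow> (0::real)) (at 0)"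
      by (auto intro!: tendsto_eq_intros)
    ultimately show ?thesis using 3 by (simp add: DERIV_def)
  qed
qed

text \<open>For r > 0 this bump is positive exactly on the open ball of radius r around c.\<close>

lemma gderiv_ball_bump:
  fixes c :: "'a::euclidean_space"
  shows "GDERIV (\<lambda>x. (max 0 (r\<^sup>2 - (x - c) \<bullet> (x - c)))\<^sup>2) x :>
    (2 * max 0 (r\<^sup>2 - (x - c) \<bullet> (x - c))) *\<^sub>R (- 2 *\<^sub>R (x - c))"
proof (rule GDERIV_DERIV_compose[OF _ has_derivative_pos_part_square])
  show "GDERIV (\<lambda>x. r\<^sup>2 - (x - c) \<bullet> (x - c)) x :> - 2 *\<^sub>R (x - c)"
    unfolding gderiv_def
    by (auto intro!: derivative_eq_intros simp: fun_eq_iff inner_commute algebra_simps)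
qed

lemma gderiv_sum:
  assumes "\<And>i. i \<in> I \<Longrightarrow> GDERIV (f i) x :> G i"
  shows "GDERIV (\<lambda>x. \<Sum>i\<in>I. f i x) x :> (\<Sum>i\<in>I. G i)"
  using assms unfolding gderiv_def inner_sum_right by (intro has_derivative_sum) auto

text \<open>If \<open>\<theta>\<close> is nonnegative and \<open>C\<^sup>1\<close>, then \<open>N \<theta> / (1 + N \<theta>)\<close> is \<open>C\<^sup>1\<close> and tends to the
  indicator function of \<open>{\<theta> > 0}\<close>.\<close>

lemma indicator_limit_test_functions:
  fixes V :: "'a::euclidean_space set"
  assumes "open V"
  obtains \<phi> :: "nat \<Rightarrow> 'a \<Rightarrow> real" where
    "\<And>N. test_function V (\<phi> N)" "\<And>N x. \<bar>\<phi> N x\<bar> \<le> 1"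
    "\<And>x. (\<lambda>N. \<phi> N x) \<longlonglongrightarrow> indicator V x"
proof (cases "V = {}")
  case True
  have "test_function V (\<lambda>x. 0)"
    by (rule test_functionI[where G = "\<lambda>x. 0"]) (auto simp: GDERIV_const)
  then show ?thesis by (intro that[of "\<lambda>N x. 0"]) (auto simp: True)
next
  case False
  \<comment> \<open>Requiring the closed balls to lie in \<open>V\<close> makes finite unions of
    them compact subsets of \<open>V\<close>, which later contain the supports. Lindelof makes the
    family countable, so that partial sums of bumps can be formed.\<close>
  define \<F> where "\<F> = {ball c r | c r. r > 0 \<and> cball c r \<subseteq> V}"
  have "\<exists>B\<in>\<F>. x \<in> B" if x: "x \<in> V" for x
  proof -
    obtain e where "e > 0" "cball x e \<subseteq> V"
      using assms x open_contains_cball by blast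
    then have "ball x e \<in> \<F>" "x \<in> ball x e" unfolding \<F>_def by auto
    then show ?thesis by blast
  qed
  moreover have "B \<subseteq> V" if "B \<in> \<F>" for B
    using that ball_subset_cball unfolding \<F>_def by fast
  ultimately have \<F>: "\<Union>\<F> = V" by blast
  have "\<And>S. S \<in> \<F> \<Longrightarrow> open S" by (auto simp: \<F>_def)
  then obtain \<F>' where \<F>': "\<F>' \<subseteq> \<F>" "countable \<F>'" "\<Union>\<F>' = V"
    using Lindelof[of \<F>] \<F> by metis
  then have ne: "\<F>' \<noteq> {}" using False by auto
  have "\<exists>c r. from_nat_into \<F>' i = ball c r \<and> r > 0 \<and> cball c r \<subseteq> V" for i
  proof -
    have "from_nat_into \<F>' i \<in> \<F>" using from_nat_into[OF ne, of i] \<F>'(1) by blast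
    then show ?thesis unfolding \<F>_def by fast
  qed
  then obtain c r where
    ball: "\<And>i. from_nat_into \<F>' i = ball (c i) (r i)" and r0: "\<And>i. r i > 0"
    and cball: "\<And>i. cball (c i) (r i) \<subseteq> V"
    by metis
  have V: "V = (\<Union>i. ball (c i) (r i))"
    using range_from_nat_into[OF ne \<F>'(2)] \<F>'(3) by (simp flip: ball)
  define \<theta> where "\<theta> i x = (max 0 ((r i)\<^sup>2 - (x - c i) \<bullet> (x - c i)))\<^sup>2" for i x
  define H where "H i x = (2 * max 0 ((r i)\<^sup>2 - (x - c i) \<bullet> (x - c i))) *\<^sub>R (- 2 *\<^sub>R (x - c i))" for i x
  have \<theta>H: "GDERIV (\<theta> i) x :> H i x" for i x
    unfolding \<theta>_def H_def by (rule gderiv_ball_bump)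
  have \<theta>0: "\<theta> i x \<ge> 0" for i x by (simp add: \<theta>_def)
  have \<theta>pos: "\<theta> i x \<noteq> 0 \<longleftrightarrow> x \<in> ball (c i) (r i)" for i x
  proof -
    have "\<theta> i x \<noteq> 0 \<longleftrightarrow> (norm (x - c i))\<^sup>2 < (r i)\<^sup>2"
      by (auto simp: \<theta>_def power2_norm_eq_inner max_def)
    also have "\<dots> \<longleftrightarrow> norm (x - c i) < r i"
      using r0[of i] by (simp add: power_mono_iff flip: not_le)
    finally show ?thesis by (simp add: dist_norm norm_minus_commute)
  qed
  define \<Theta> where "\<Theta> N x = (\<Sum>i<N. \<theta> i x)" for N x
  define K where "K N x = (\<Sum>i<N. H i x)" for N x
  have \<Theta>K: "GDERIV (\<Theta> N) x :> K N x" for N x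
    unfolding \<Theta>_def K_def by (intro gderiv_sum \<theta>H)
  have \<Theta>0: "\<Theta> N x \<ge> 0" for N x by (simp add: \<Theta>_def sum_nonneg \<theta>0)
  have \<Theta>cont: "continuous_on UNIV (\<Theta> N)" for N
    unfolding \<Theta>_def \<theta>_def by (intro continuous_intros)
  have den: "1 + real N * \<Theta> N x > 0" for N x
    using \<Theta>0[of N x] by (simp add: add_pos_nonneg)
  \<comment> \<open>\<open>N\<close> has two roles: it counts the balls in use, which keeps the
    support compact, and it is the steepness that drives the quotient to 1 wherever some bump is
    positive.\<close>
  define \<phi> where "\<phi> N x = real N * \<Theta> N x / (1 + real N * \<Theta> N x)" for N x
  define G where "G N x = (real N / (1 + real N * \<Theta> N x)\<^sup>2) *\<^sub>R K N x" for N x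
  have G: "GDERIV (\<phi> N) x :> G N x" for N x
    unfolding \<phi>_def G_def
  proof (rule GDERIV_DERIV_compose[OF \<Theta>K])
    show "((\<lambda>t. real N * t / (1 + real N * t)) has_real_derivative
        real N / (1 + real N * \<Theta> N x)\<^sup>2) (at (\<Theta> N x))"
      using den[of N x]
      by (auto intro!: derivative_eq_intros simp: power2_eq_square field_simps)
  qed
  have "continuous_on UNIV (K N)" for N
    unfolding K_def H_def by (intro continuous_intros)
  then have Gcont: "continuous_on UNIV (G N)" for N
    unfolding G_def using den[of N]
    by (intro continuous_intros \<Theta>cont) (auto simp: less_imp_neq[symmetric])
  have "test_function V (\<phi> N)" for N
  proof (rule test_functionI[OF G Gcont])
    let ?C = "\<Union>i<N. cball (c i) (r i)"
    have supp: "{x. \<phi> N x \<noteq> 0} \<subseteq> ?C"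
    proof
      fix x assume "x \<in> {x. \<phi> N x \<noteq> 0}"
      then have "\<Theta> N x \<noteq> 0" by (auto simp: \<phi>_def)
      then obtain i where i: "i < N" "\<theta> i x \<noteq> 0"
        unfolding \<Theta>_def by (metis lessThan_iff sum.neutral)
      then have "x \<in> cball (c i) (r i)" using \<theta>pos ball_subset_cball by blast
      with i(1) show "x \<in> ?C" by blast
    qed
    have C: "compact ?C" by (intro compact_UN) auto
    then show "bounded {x. \<phi> N x \<noteq> 0}"
      using supp bounded_subset compact_imp_bounded by blast
    have "closure {x. \<phi> N x \<noteq> 0} \<subseteq> ?C"
      using supp compact_imp_closed[OF C] by (rule closure_minimal)
    then show "closure {x. \<phi> N x \<noteq> 0} \<subseteq> V" using cball by blast
  qed
  moreover have bound: "\<bar>\<phi> N x\<bar> \<le> 1" for N x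
    using den[of N x] \<Theta>0[of N x] by (simp add: \<phi>_def)
  moreover have "(\<lambda>N. \<phi> N x) \<longlonglongrightarrow> indicator V x" for x
  proof (cases "x \<in> V")
    case True
    then obtain i where "x \<in> ball (c i) (r i)" using V by blast
    then have pos: "\<theta> i x > 0" using \<theta>pos[of i x] \<theta>0[of i x] by linarith
    \<comment> \<open>The quotient is 1 - 1 / (1 + N t) at t = \<open>\<Theta> N x\<close>, which
      increases with t. Once bump i belongs to the sum, its fixed positive value can replace t, and
      the resulting bound tends to 1.\<close>
    have lower: "1 - 1 / (1 + real N * \<theta> i x) \<le> \<phi> N x" if "N > i" for N
    proof -
      have "\<theta> i x \<le> \<Theta> N x"
        unfolding \<Theta>_def by (rule member_le_sum) (use that \<theta>0 in auto)
      then have "1 + real N * \<theta> i x \<le> 1 + real N * \<Theta> N x"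
        by (simp add: mult_left_mono)
      moreover have "\<phi> N x = 1 - 1 / (1 + real N * \<Theta> N x)"
        using den[of N x] by (simp add: \<phi>_def field_simps)
      moreover have "1 + real N * \<theta> i x > 0" using pos by (simp add: add_pos_nonneg)
      ultimately show ?thesis by (simp add: frac_le)
    qed
    have lim: "(\<lambda>N. 1 - 1 / (1 + real N * \<theta> i x)) \<longlonglongrightarrow> 1"
    proof -
      have "filterlim (\<lambda>N. real N * \<theta> i x) at_top sequentially"
        by (rule filterlim_at_top_mult_tendsto_pos[OF tendsto_const pos filterlim_real_sequentially])
      then have "filterlim (\<lambda>N. 1 + real N * \<theta> i x) at_top sequentially"
        by (rule filterlim_tendsto_add_at_top[OF tendsto_const])
      then have "(\<lambda>N. inverse (1 + real N * \<theta> i x)) \<longlonglongrightarrow> 0"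
        by (rule tendsto_inverse_0_at_top)
      from tendsto_diff[OF tendsto_const[of 1] this] show ?thesis
        by (simp add: inverse_eq_divide)
    qed
    have "(\<lambda>N. \<phi> N x) \<longlonglongrightarrow> 1"
    proof (rule tendsto_sandwich[OF _ _ lim tendsto_const])
      show "\<forall>\<^sub>F N in sequentially. 1 - 1 / (1 + real N * \<theta> i x) \<le> \<phi> N x"
        using eventually_gt_at_top[of i] by eventually_elim (rule lower)
      show "\<forall>\<^sub>F N in sequentially. \<phi> N x \<le> 1"
        using bound by (simp add: abs_le_iff)
    qed
    with True show ?thesis by simp
  next
    case False
    then have "\<theta> i x = 0" for i using V \<theta>pos[of i x] by blast
    then have "\<phi> N x = 0" for N by (simp add: \<phi>_def \<Theta>_def)
    with False show ?thesis by simp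
  qed
  ultimately show ?thesis by (rule that)
qed

section \<open>The fundamental lemma of the calculus of variations\<close>

text \<open>Dominated convergence along test functions that are bounded by 1 and tend to the
  indicator of \<open>V\<close>, with |h| as majorant.\<close>

lemma integral_open_eq_0_if_test_functions:
  fixes h :: "'a::euclidean_space \<Rightarrow> real"
  assumes h: "integrable lebesgue h"
    and orth: "\<And>\<phi>. test_function V \<phi> \<Longrightarrow> (LINT x|lebesgue. h x * \<phi> x) = 0"
    and V: "open V"
  shows "(LINT x:V|lebesgue. h x) = 0"
proof -
  obtain \<phi> :: "nat \<Rightarrow> 'a \<Rightarrow> real" where \<phi>:
    "\<And>N. test_function V (\<phi> N)" "\<And>N x. \<bar>\<phi> N x\<bar> \<le> 1"
    "\<And>x. (\<lambda>N. \<phi> N x) \<longlonglongrightarrow> indicator V x"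
    using indicator_limit_test_functions[OF V] by blast
  have meas: "\<phi> N \<in> borel_measurable lebesgue" for N
  proof -
    have "continuous_on UNIV (\<phi> N)"
      using \<phi>(1)[of N] unfolding test_function_def
      by (simp add: continuous_at_imp_continuous_on differentiable_imp_continuous_within)
    then show ?thesis
      by (intro measurable_completion) (simp add: borel_measurable_continuous_onI)
  qed
  have [measurable]: "h \<in> borel_measurable lebesgue" using h by auto
  have "(\<lambda>N. LINT x|lebesgue. h x * \<phi> N x) \<longlonglongrightarrow> (LINT x|lebesgue. h x * indicator V x)"
  proof (rule integral_dominated_convergence[where w = "\<lambda>x. \<bar>h x\<bar>"])
    show "AE x in lebesgue. norm (h x * \<phi> N x) \<le> \<bar>h x\<bar>" for N
      using \<phi>(2) by (auto simp: abs_mult intro!: mult_left_le)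
    show "(\<lambda>x. h x * indicator V x) \<in> borel_measurable lebesgue"
      using V by (auto intro!: borel_measurable_times borel_measurable_indicator)
    show "AE x in lebesgue. (\<lambda>N. h x * \<phi> N x) \<longlonglongrightarrow> h x * indicator V x"
      using \<phi>(3) by (auto intro!: tendsto_mult)
  qed (use h meas in auto)
  then have "(LINT x|lebesgue. h x * indicator V x) = 0"
    using orth[OF \<phi>(1)] by (simp add: LIMSEQ_const_iff)
  then show ?thesis by (simp add: set_lebesgue_integral_def mult.commute)
qed

text \<open>The set of positivity need not be open, so it is exhausted from inside by closed sets C.
  Both \<open>V\<close> and \<open>V - C\<close> are open, hence h integrates to 0 over each of them
  and thus over C. As h is positive on C, C is null, and the set itself has measure below any e >
  0.\<close>

lemma null_set_pos_if_orthogonal_test_functions: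
  fixes h :: "'a::euclidean_space \<Rightarrow> real"
  assumes h: "integrable lebesgue h"
    and orth: "\<And>\<phi>. test_function V \<phi> \<Longrightarrow> (LINT x|lebesgue. h x * \<phi> x) = 0"
    and V: "open V"
  shows "{x\<in>V. h x > 0} \<in> null_sets lebesgue"
proof -
  let ?A = "{x\<in>V. h x > 0}"
  have [measurable]: "h \<in> borel_measurable lebesgue" "V \<in> sets lebesgue" using h V by auto
  have A: "?A \<in> sets lebesgue" by measurable
  have le: "emeasure lebesgue ?A \<le> ennreal e" if e: "e > 0" for e
  proof -
    obtain C where C: "closed C" "C \<subseteq> ?A" "emeasure lebesgue (?A - C) < ennreal e"
      using sets_lebesgue_inner_closed[OF A e] by metis
    have Cm: "C \<in> sets lebesgue" using C(1) by auto
    have int: "set_integrable lebesgue S h" if "S \<in> sets lebesgue" for S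
      unfolding set_integrable_def using h that by (rule integrable_mult_indicator[rotated])
    have "open (V - C)" using V C(1) by blast
    moreover have "(LINT x|lebesgue. h x * \<phi> x) = 0" if "test_function (V - C) \<phi>" for \<phi>
      by (rule orth[OF test_function_mono[OF that]]) auto
    ultimately have 1: "(LINT x:(V - C)|lebesgue. h x) = 0"
      by (intro integral_open_eq_0_if_test_functions[OF h])
    have 2: "(LINT x:V|lebesgue. h x) = 0"
      by (rule integral_open_eq_0_if_test_functions[OF h orth V])
    have "V = C \<union> (V - C)" using C(2) by blast
    then have "(LINT x:V|lebesgue. h x) = (LINT x:C|lebesgue. h x) + (LINT x:(V - C)|lebesgue. h x)"
      using set_integral_Un[of C "V - C" lebesgue h] int Cm by auto
    then have "(LINT x:C|lebesgue. h x) = 0" using 1 2 by simp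
    then have "C \<in> null_sets lebesgue"
      using C(2) by (intro null_if_pos_func_has_zero_int[OF h Cm]) auto
    then have "emeasure lebesgue C = 0" by blast
    have "?A = C \<union> (?A - C)" using C(2) by blast
    then have "emeasure lebesgue ?A \<le> emeasure lebesgue C + emeasure lebesgue (?A - C)"
      using emeasure_subadditive[of C lebesgue "?A - C"] Cm A by (metis sets.Diff)
    with \<open>emeasure lebesgue C = 0\<close> C(3) show ?thesis by simp
  qed
  have "emeasure lebesgue ?A \<le> 0"
  proof (rule ennreal_le_epsilon)
    show "emeasure lebesgue ?A \<le> 0 + ennreal e" if "0 < e" for e
      using le[OF that] by simp
  qed
  with A show ?thesis by auto
qed

lemma AE_eq_0_if_orthogonal_test_functions:
  fixes h :: "'a::euclidean_space \<Rightarrow> real"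
  assumes h: "integrable lebesgue h"
    and orth: "\<And>\<phi>. test_function V \<phi> \<Longrightarrow> (LINT x|lebesgue. h x * \<phi> x) = 0"
    and V: "open V"
  shows "AE x in lebesgue. x \<in> V \<longrightarrow> h x = 0"
proof -
  have "{x\<in>V. - h x > 0} \<in> null_sets lebesgue"
    by (rule null_set_pos_if_orthogonal_test_functions[OF _ _ V]) (use h orth in auto)
  then have "AE x in lebesgue. x \<notin> {x\<in>V. - h x > 0}" by (rule AE_not_in)
  moreover have "AE x in lebesgue. x \<notin> {x\<in>V. h x > 0}"
    by (rule AE_not_in[OF null_set_pos_if_orthogonal_test_functions[OF h orth V]])
  ultimately show ?thesis by eventually_elim force
qed

section \<open>Integration by parts against test functions\<close>

lemma integrable_continuous_bounded_support:
  fixes f :: "'a::euclidean_space \<Rightarrow> real"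
  assumes "continuous_on UNIV f" "bounded {x. f x \<noteq> 0}"
  shows "integrable lborel f"
proof -
  obtain R where R: "\<And>x. f x \<noteq> 0 \<Longrightarrow> norm x \<le> R"
    using assms(2) by (auto simp: bounded_iff)
  have "integrable lborel (\<lambda>x. indicator (cball 0 R) x *\<^sub>R f x)"
    by (rule borel_integrable_compact) (use assms(1) continuous_on_subset in auto)
  also have "(\<lambda>x. indicator (cball 0 R) x *\<^sub>R f x) = f"
  proof
    show "indicator (cball 0 R) x *\<^sub>R f x = f x" for x
      using R[of x] by (cases "f x = 0") auto
  qed
  finally show ?thesis .
qed

text \<open>By translation invariance the difference quotients of \<open>g\<close> have integral 0, and they converge
  boundedly to the directional derivative.\<close>

lemma integral_directional_derivative_eq_0:
  fixes g :: "'a::euclidean_space \<Rightarrow> real"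
  assumes D: "\<And>x. (g has_derivative D x) (at x)"
    and cont: "continuous_on UNIV (\<lambda>x. D x e)"
    and supp: "bounded {x. g x \<noteq> 0}"
  shows "(LINT x|lborel. D x e) = 0"
proof -
  obtain R where R: "\<And>x. g x \<noteq> 0 \<Longrightarrow> norm x \<le> R"
    using supp by (auto simp: bounded_iff)
  have deriv: "((\<lambda>t. g (x + t *\<^sub>R e)) has_real_derivative D (x + t *\<^sub>R e) e) (at t)" for x t
  proof -
    interpret bounded_linear "D (x + t *\<^sub>R e)" using D by (rule has_derivative_bounded_linear)
    have "((\<lambda>t. x + t *\<^sub>R e) has_derivative (\<lambda>s. s *\<^sub>R e)) (at t)"
      by (auto intro!: derivative_eq_intros)
    from has_derivative_compose[OF this D] show ?thesis
      by (simp add: has_field_derivative_def scale mult.commute[of _ "D _ e"])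
  qed
  \<comment> \<open>All difference quotients used below have steps of length at most |e|, so they
    vanish outside the ball of radius R + |e|.\<close>
  have "compact ((\<lambda>x. D x e) ` cball 0 (R + norm e))"
    by (intro compact_continuous_image continuous_on_subset[OF cont]) auto
  then have "bounded ((\<lambda>x. D x e) ` cball 0 (R + norm e))" by (rule compact_imp_bounded)
  then obtain M where "M > 0" "\<forall>x\<in>cball 0 (R + norm e). \<bar>D x e\<bar> \<le> M"
    unfolding bounded_pos by auto
  then have M: "\<bar>D x e\<bar> \<le> M" if "norm x \<le> R + norm e" for x
    using that by simp
  have zero: "D x e = 0" if "norm x > R" for x
  proof -
    have "open {y :: 'a. norm y > R}" by (intro open_Collect_less continuous_intros)
    moreover have "x \<in> {y. norm y > R}" using that by simp
    moreover have "0 = g y" if "y \<in> {y. norm y > R}" for y using R[of y] that by force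
    ultimately have "(g has_derivative (\<lambda>_. 0)) (at x)"
      by (rule has_derivative_transform_within_open[OF has_derivative_const])
    then have "D x = (\<lambda>_. 0)" by (rule has_derivative_unique[OF D])
    then show ?thesis by simp
  qed
  \<comment> \<open>A bound on the whole space is needed, since the intermediate points of the mean
    value theorem may leave the ball.\<close>
  have M': "\<bar>D x e\<bar> \<le> M" for x
    using M[of x] zero[of x] \<open>M > 0\<close> norm_ge_zero[of e] by (cases "norm x > R") auto
  have gcont: "continuous_on UNIV g"
    by (intro continuous_at_imp_continuous_on ballI has_derivative_continuous[OF D])
  then have gint: "integrable lborel g"
    using supp by (rule integrable_continuous_bounded_support)
  have gmeas: "g \<in> borel_measurable borel" using gcont by (rule borel_measurable_continuous_onI)
  have shift_int: "integrable lborel (\<lambda>x. g (x + c))"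
    and shift_eq: "(LINT x|lborel. g (x + c)) = (LINT x|lborel. g x)" for c
  proof -
    have "integrable (distr lborel borel ((+) c)) g" using gint by (simp add: lborel_distr_plus)
    then show "integrable lborel (\<lambda>x. g (x + c))"
      using gmeas by (subst (asm) integrable_distr_eq) (auto simp: add.commute)
    have "(LINT x|lborel. g x) = (LINT x|distr lborel borel ((+) c). g x)"
      by (simp add: lborel_distr_plus)
    also have "\<dots> = (LINT x|lborel. g (x + c))"
      using gmeas by (subst integral_distr) (auto simp: add.commute)
    finally show "(LINT x|lborel. g (x + c)) = (LINT x|lborel. g x)" by simp
  qed
  \<comment> \<open>A sequence, as dominated convergence requires, with values in (0,1], so that one
    ball serves for all n.\<close>
  define s where "s n = inverse (real (Suc n))" for n
  have s: "0 < s n" "s n \<le> 1" for n by (simp_all add: s_def inverse_le_1_iff)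
  have "s \<longlonglongrightarrow> 0" unfolding s_def by (rule LIMSEQ_inverse_real_of_nat)
  then have slim: "filterlim s (at 0) sequentially"
    using s(1) by (auto simp: filterlim_at less_imp_neq[symmetric])
  define q where "q n x = (g (x + s n *\<^sub>R e) - g x) / s n" for n x
  have qlim: "(\<lambda>n. q n x) \<longlonglongrightarrow> D x e" for x
  proof -
    have "((\<lambda>h. (g (x + h *\<^sub>R e) - g x) / h) \<longlongrightarrow> D x e) (at 0)"
      using deriv[of x 0] by (simp add: DERIV_def)
    from filterlim_compose[OF this slim] show ?thesis by (simp add: q_def)
  qed
  have qbound: "\<bar>q n x\<bar> \<le> M * indicator (cball 0 (R + norm e)) x" for n x
  proof (cases "norm x \<le> R + norm e")
    case True
    \<comment> \<open>The mean value theorem turns the bound on the derivative into one on the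
      quotients, uniform in n.\<close>
    obtain z where "g (x + s n *\<^sub>R e) - g (x + 0 *\<^sub>R e) = (s n - 0) * D (x + z *\<^sub>R e) e"
      using MVT2[of 0 "s n" "\<lambda>t. g (x + t *\<^sub>R e)" "\<lambda>t. D (x + t *\<^sub>R e) e"] deriv s(1) by blast
    then have "q n x = D (x + z *\<^sub>R e) e" using s(1)[of n] by (simp add: q_def)
    then show ?thesis using M' True by simp
  next
    case False
    have "norm (s n *\<^sub>R e) \<le> norm e" using s[of n] by (simp add: mult_left_le_one_le)
    then have "norm (x + s n *\<^sub>R e) > R" "norm x > R"
      using False norm_diff_ineq[of x "s n *\<^sub>R e"] norm_ge_zero[of e] by linarith+
    then have "g (x + s n *\<^sub>R e) = 0" "g x = 0" using R by force+
    then show ?thesis using \<open>M > 0\<close> by (simp add: q_def)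
  qed
  have "(LINT x|lborel. q n x) = 0" for n
    unfolding q_def using shift_int gint by (simp add: shift_eq)
  moreover have "(\<lambda>n. LINT x|lborel. q n x) \<longlonglongrightarrow> (LINT x|lborel. D x e)"
  proof (rule integral_dominated_convergence)
    show "(\<lambda>x. D x e) \<in> borel_measurable lborel"
      using borel_measurable_continuous_onI[OF cont] by simp
    show "q n \<in> borel_measurable lborel" for n
      unfolding q_def
      using borel_measurable_integrable[OF shift_int] borel_measurable_integrable[OF gint]
      by (intro borel_measurable_divide borel_measurable_diff) auto
    show "integrable lborel (\<lambda>x. M * indicator (cball 0 (R + norm e)) x)"
      by (intro integrable_mult_right integrable_real_indicator emeasure_bounded_finite) auto
  qed (use qlim qbound in auto)
  ultimately show ?thesis by (simp add: LIMSEQ_const_iff)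
qed

lemma test_function_continuous:
  assumes "test_function V \<phi>"
  shows "continuous_on UNIV \<phi>" "continuous_on UNIV (grad \<phi>)"
  using assms unfolding test_function_def
  by (auto simp: continuous_at_imp_continuous_on differentiable_imp_continuous_within)

lemma test_function_bounded_support:
  assumes "test_function V \<phi>"
  shows "bounded {x. \<phi> x \<noteq> 0}" "bounded {x. grad \<phi> x \<noteq> 0}"
proof -
  let ?S = "closure {x. \<phi> x \<noteq> 0}"
  have S: "compact ?S" using assms by (simp add: test_function_def)
  then show "bounded {x. \<phi> x \<noteq> 0}"
    using bounded_subset closure_subset compact_imp_bounded by metis
  \<comment> \<open>The set in \<open>test_function\<close> only constrains the support, so a test
    function is also one for its own closed support.\<close>
  have "test_function ?S \<phi>" using assms by (simp add: test_function_def)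
  then have "{x. grad \<phi> x \<noteq> 0} \<subseteq> ?S" using test_function_outside(2) by blast
  then show "bounded {x. grad \<phi> x \<noteq> 0}"
    using S bounded_subset compact_imp_bounded by metis
qed

text \<open>For each basis vector b the product of \<open>\<phi>\<close> with the b-component of
  \<open>P\<close> has bounded support, so its derivative along b integrates to 0. Summing the
  product rule over b yields the two integrals.\<close>

lemma integral_divergence_test_function:
  fixes P :: "'a::euclidean_space \<Rightarrow> 'a"
  assumes P: "\<And>x. (P has_derivative P' x) (at x)"
    and P': "\<And>b. b \<in> Basis \<Longrightarrow> continuous_on UNIV (\<lambda>x. P' x b)"
    and \<phi>: "test_function V \<phi>"
  shows "integrable lborel (\<lambda>x. (\<Sum>b\<in>Basis. P' x b \<bullet> b) * \<phi> x)"
    and "(LINT x|lborel. P x \<bullet> grad \<phi> x) = - (LINT x|lborel. (\<Sum>b\<in>Basis. P' x b \<bullet> b) * \<phi> x)"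
proof -
  note cont = test_function_continuous[OF \<phi>]
  note supp = test_function_bounded_support[OF \<phi>]
  have Pcont: "continuous_on UNIV P"
    by (intro continuous_at_imp_continuous_on ballI has_derivative_continuous[OF P])
  have int1: "integrable lborel (\<lambda>x. P x \<bullet> grad \<phi> x)"
    by (intro integrable_continuous_bounded_support continuous_intros Pcont cont bounded_subset[OF supp(2)]) auto
  show int2: "integrable lborel (\<lambda>x. (\<Sum>b\<in>Basis. P' x b \<bullet> b) * \<phi> x)"
    by (intro integrable_continuous_bounded_support continuous_intros P' cont bounded_subset[OF supp(1)]) auto
  define D where "D b x h = \<phi> x * (P' x h \<bullet> b) + (h \<bullet> grad \<phi> x) * (P x \<bullet> b)" for b x h
  have D: "((\<lambda>x. \<phi> x * (P x \<bullet> b)) has_derivative D b x) (at x)" for b x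
    unfolding D_def
    using test_function_gderiv[OF \<phi>, of x, unfolded gderiv_def] P[of x]
    by (intro has_derivative_mult has_derivative_inner_left)
  have Dcont: "continuous_on UNIV (\<lambda>x. D b x b)" if "b \<in> Basis" for b
    unfolding D_def by (intro continuous_intros P' that cont Pcont)
  have "(LINT x|lborel. D b x b) = 0" if "b \<in> Basis" for b
    by (rule integral_directional_derivative_eq_0[OF D Dcont[OF that]])
      (auto intro: bounded_subset[OF supp(1)])
  then have "0 = (\<Sum>b\<in>Basis. LINT x|lborel. D b x b)" by simp
  also have "\<dots> = (LINT x|lborel. (\<Sum>b\<in>Basis. D b x b))"
  proof (rule Bochner_Integration.integral_sum[symmetric])
    fix b :: 'a assume b: "b \<in> Basis"
    have "{x. D b x b \<noteq> 0} \<subseteq> {x. \<phi> x \<noteq> 0} \<union> {x. grad \<phi> x \<noteq> 0}" by (auto simp: D_def)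
    then show "integrable lborel (\<lambda>x. D b x b)"
      using supp by (intro integrable_continuous_bounded_support Dcont b) (metis bounded_Un bounded_subset)
  qed
  also have "(\<lambda>x. \<Sum>b\<in>Basis. D b x b) = (\<lambda>x. P x \<bullet> grad \<phi> x + (\<Sum>b\<in>Basis. P' x b \<bullet> b) * \<phi> x)"
    by (auto simp: fun_eq_iff D_def sum.distrib euclidean_inner[of "P _"] sum_distrib_left
        inner_commute mult.commute)
  also have "(LINT x|lborel. P x \<bullet> grad \<phi> x + (\<Sum>b\<in>Basis. P' x b \<bullet> b) * \<phi> x) =
      (LINT x|lborel. P x \<bullet> grad \<phi> x) + (LINT x|lborel. (\<Sum>b\<in>Basis. P' x b \<bullet> b) * \<phi> x)"
    using int1 int2 by (rule Bochner_Integration.integral_add)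
  finally show "(LINT x|lborel. P x \<bullet> grad \<phi> x) = - (LINT x|lborel. (\<Sum>b\<in>Basis. P' x b \<bullet> b) * \<phi> x)"
    by simp
qed

section \<open>The weak divergence where the field is smooth\<close>

lemma integral_lebesgue_on_open:
  fixes f :: "'a::euclidean_space \<Rightarrow> real"
  assumes "open \<Omega>"
  shows "(LINT x|lebesgue_on \<Omega>. f x) = (LINT x|lebesgue. indicator \<Omega> x * f x)"
    and "integrable (lebesgue_on \<Omega>) f \<longleftrightarrow> integrable lebesgue (\<lambda>x. indicator \<Omega> x * f x)"
  using assms by (simp_all add: integral_restrict_space integrable_restrict_space)

lemma square_integrable_imp_integrable_lebesgue_on:
  fixes d :: "'a::euclidean_space \<Rightarrow> real"
  assumes "open \<Omega>" "bounded \<Omega>" "square_integrable \<Omega> d"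
  shows "integrable (lebesgue_on \<Omega>) d"
proof -
  interpret finite_measure "lebesgue_on \<Omega>"
    by (rule finite_measure_lebesgue_on[OF lmeasurable_open[OF assms(2,1)]])
  show ?thesis
    by (rule square_integrable_imp_integrable) (use assms(3) in \<open>auto simp: square_integrable_def\<close>)
qed

text \<open>Test functions supported in \<open>V\<close> cannot distinguish u from \<open>P\<close>.
  The weak formulation for u and integration by parts for \<open>P\<close> then show that the
  difference of the two divergences is orthogonal to all of them.\<close>

lemma weak_div_eq_classical_div:
  fixes u P :: "'a::euclidean_space \<Rightarrow> 'a"
  assumes \<Omega>: "open \<Omega>" "bounded \<Omega>"
    and d: "square_integrable \<Omega> d" "has_weak_div \<Omega> u d"
    and V: "open V" "V \<subseteq> \<Omega>"
    and u: "\<And>x. x \<in> V \<Longrightarrow> u x = P x"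
    and P: "\<And>x. (P has_derivative P' x) (at x)"
    and P': "\<And>b. b \<in> Basis \<Longrightarrow> continuous_on UNIV (\<lambda>x. P' x b)"
  shows "AE x in lebesgue. x \<in> V \<longrightarrow> d x = (\<Sum>b\<in>Basis. P' x b \<bullet> b)"
proof -
  define D where "D x = (\<Sum>b\<in>Basis. P' x b \<bullet> b)" for x
  \<comment> \<open>The cut-off to \<open>\<Omega>\<close> makes the difference integrable on the
    whole space, as the fundamental lemma requires: \<open>D\<close> is continuous everywhere but
    integrable only on bounded sets.\<close>
  define h where "h x = indicator \<Omega> x * (d x - D x)" for x
  have Dcont: "continuous_on UNIV D" unfolding D_def by (intro continuous_intros P')
  have Dmeas: "D \<in> borel_measurable lebesgue"
    by (intro measurable_completion) (simp add: borel_measurable_continuous_onI[OF Dcont])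
  have dint: "integrable lebesgue (\<lambda>x. indicator \<Omega> x * d x)"
    using square_integrable_imp_integrable_lebesgue_on[OF \<Omega> d(1)]
    by (simp add: integral_lebesgue_on_open(2)[OF \<Omega>(1)])
  \<comment> \<open>Integrability of a continuous function is available on compact sets, hence the
    detour through the closure of \<open>\<Omega>\<close>.\<close>
  have "integrable lborel (\<lambda>x. indicator (closure \<Omega>) x *\<^sub>R D x)"
    using \<Omega>(2) Dcont by (intro borel_integrable_compact) (auto intro: continuous_on_subset)
  then have "integrable lebesgue (\<lambda>x. indicator (closure \<Omega>) x *\<^sub>R D x)"
    by (subst integrable_completion) auto
  then have "integrable lebesgue (\<lambda>x. indicator \<Omega> x *\<^sub>R (indicator (closure \<Omega>) x *\<^sub>R D x))"
    by (rule integrable_mult_indicator[rotated]) (use \<Omega>(1) in auto)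
  also have "(\<lambda>x. indicator \<Omega> x *\<^sub>R (indicator (closure \<Omega>) x *\<^sub>R D x)) = (\<lambda>x. indicator \<Omega> x * D x)"
    using closure_subset[of \<Omega>] by (auto simp: fun_eq_iff indicator_def)
  finally have Dint: "integrable lebesgue (\<lambda>x. indicator \<Omega> x * D x)" .
  have hint: "integrable lebesgue h"
    unfolding h_def right_diff_distrib using dint Dint by (rule Bochner_Integration.integrable_diff)
  have "(LINT x|lebesgue. h x * \<phi> x) = 0" if \<phi>: "test_function V \<phi>" for \<phi>
  proof -
    note out = test_function_outside[OF test_function_mono[OF \<phi> V(2)]]
    note cont = test_function_continuous[OF \<phi>]
    have \<phi>meas: "\<phi> \<in> borel_measurable lebesgue"
      by (intro measurable_completion) (simp add: borel_measurable_continuous_onI[OF cont(1)])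
    have "compact (closure {x. \<phi> x \<noteq> 0})" using \<phi> by (simp add: test_function_def)
    then have "bounded (\<phi> ` closure {x. \<phi> x \<noteq> 0})"
      using cont(1) by (intro compact_imp_bounded compact_continuous_image) (auto intro: continuous_on_subset)
    then obtain M where "M > 0" and M: "\<And>x. x \<in> closure {x. \<phi> x \<noteq> 0} \<Longrightarrow> \<bar>\<phi> x\<bar> \<le> M"
      unfolding bounded_pos by auto
    have M: "\<bar>\<phi> x\<bar> \<le> M" for x
      using M[of x] \<open>M > 0\<close> closure_subset[of "{x. \<phi> x \<noteq> 0}"] by (cases "\<phi> x = 0") auto
    have d\<phi>int: "integrable lebesgue (\<lambda>x. indicator \<Omega> x * d x * \<phi> x)"
    proof (rule Bochner_Integration.integrable_bound)
      show "integrable lebesgue (\<lambda>x. M * (indicator \<Omega> x * d x))" using dint by simp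
      show "(\<lambda>x. indicator \<Omega> x * d x * \<phi> x) \<in> borel_measurable lebesgue"
        using borel_measurable_integrable[OF dint] \<phi>meas by (rule borel_measurable_times)
      show "AE x in lebesgue. norm (indicator \<Omega> x * d x * \<phi> x) \<le> norm (M * (indicator \<Omega> x * d x))"
        using M \<open>M > 0\<close> by (auto simp: abs_mult mult.commute[of M] intro!: mult_left_mono)
    qed
    have ibp: "integrable lborel (\<lambda>x. D x * \<phi> x)"
      "(LINT x|lborel. P x \<bullet> grad \<phi> x) = - (LINT x|lborel. D x * \<phi> x)"
      unfolding D_def by (rule integral_divergence_test_function[OF P P' \<phi>]; assumption)+
    have D\<phi>int: "integrable lebesgue (\<lambda>x. D x * \<phi> x)"
      using ibp(1) by (subst integrable_completion) auto
    have D\<phi>eq: "(LINT x|lebesgue. D x * \<phi> x) = (LINT x|lborel. D x * \<phi> x)"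
      using ibp(1) by (intro integral_completion) auto
    have Pcont: "continuous_on UNIV P"
      by (intro continuous_at_imp_continuous_on ballI has_derivative_continuous[OF P])
    have "(LINT x|lebesgue. indicator \<Omega> x * d x * \<phi> x) = L2_inner \<Omega> d \<phi>"
      by (simp add: L2_inner_def integral_lebesgue_on_open(1)[OF \<Omega>(1)] mult.assoc)
    also have "\<dots> = - L2_inner \<Omega> u (grad \<phi>)"
      using d(2) test_function_mono[OF \<phi> V(2)] by (simp add: has_weak_div_def)
    also have "L2_inner \<Omega> u (grad \<phi>) = (LINT x|lebesgue. indicator \<Omega> x * (u x \<bullet> grad \<phi> x))"
      by (simp add: L2_inner_def integral_lebesgue_on_open(1)[OF \<Omega>(1)])
    \<comment> \<open>Off \<open>V\<close> both sides vanish with the gradient of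
      \<open>\<phi>\<close>, whatever u is there; on \<open>V\<close> the two fields
      coincide.\<close>
    also have "(\<lambda>x. indicator \<Omega> x * (u x \<bullet> grad \<phi> x)) = (\<lambda>x. P x \<bullet> grad \<phi> x)"
    proof
      show "indicator \<Omega> x * (u x \<bullet> grad \<phi> x) = P x \<bullet> grad \<phi> x" for x
        using u[of x] V(2) test_function_outside(2)[OF \<phi>, of x] by (cases "x \<in> V") auto
    qed
    also have "(LINT x|lebesgue. P x \<bullet> grad \<phi> x) = (LINT x|lborel. P x \<bullet> grad \<phi> x)"
      by (intro integral_completion)
        (simp add: borel_measurable_continuous_onI continuous_on_inner[OF Pcont cont(2)])
    finally have *: "(LINT x|lebesgue. indicator \<Omega> x * d x * \<phi> x) = (LINT x|lebesgue. D x * \<phi> x)"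
      by (simp add: ibp(2) D\<phi>eq)
    have "h x * \<phi> x = indicator \<Omega> x * d x * \<phi> x - D x * \<phi> x" for x
      using out(1)[of x] by (cases "x \<in> \<Omega>") (auto simp: h_def algebra_simps)
    then have "(LINT x|lebesgue. h x * \<phi> x) =
        (LINT x|lebesgue. indicator \<Omega> x * d x * \<phi> x) - (LINT x|lebesgue. D x * \<phi> x)"
      using d\<phi>int D\<phi>int by simp
    with * show ?thesis by simp
  qed
  then have "AE x in lebesgue. x \<in> V \<longrightarrow> h x = 0"
    by (rule AE_eq_0_if_orthogonal_test_functions[OF hint _ V(1)])
  then show ?thesis
    by eventually_elim (use V(2) in \<open>auto simp: h_def D_def\<close>)
qed

text \<open>Completeness of Lebesgue measure: preimages under f and g within \<open>\<Omega>\<close>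
  differ by a null set. This will give measurability of the corrected copy of the
  divergence.\<close>

lemma borel_measurable_lebesgue_on_AE_eq:
  fixes f g :: "'a::euclidean_space \<Rightarrow> real"
  assumes f: "f \<in> borel_measurable (lebesgue_on \<Omega>)" and \<Omega>: "open \<Omega>"
    and eq: "AE x in lebesgue. x \<in> \<Omega> \<longrightarrow> f x = g x"
  shows "g \<in> borel_measurable (lebesgue_on \<Omega>)"
proof (rule measurableI)
  have sets: "S \<in> sets (lebesgue_on \<Omega>) \<longleftrightarrow> S \<subseteq> \<Omega> \<and> S \<in> sets lebesgue" for S
    using \<Omega> by (auto simp: sets_restrict_space_iff)
  fix A :: "real set" assume "A \<in> sets borel"
  then have "f -` A \<inter> space (lebesgue_on \<Omega>) \<in> sets (lebesgue_on \<Omega>)"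
    using f measurable_sets by blast
  then have "f -` A \<inter> \<Omega> \<in> sets lebesgue" by (simp add: sets)
  moreover have "AE x in lebesgue. x \<in> f -` A \<inter> \<Omega> \<longleftrightarrow> x \<in> g -` A \<inter> \<Omega>"
    using eq by eventually_elim auto
  ultimately have "g -` A \<inter> \<Omega> \<in> sets lebesgue"
    using completion.in_sets_AE[of "f -` A \<inter> \<Omega>" "g -` A \<inter> \<Omega>" lborel] by simp
  then show "g -` A \<inter> space (lebesgue_on \<Omega>) \<in> sets (lebesgue_on \<Omega>)" by (simp add: sets)
qed simp

section \<open>Polynomials of bounded total degree and their derivatives\<close>

definition monomial :: "('n::finite \<Rightarrow> nat) \<Rightarrow> real^'n \<Rightarrow> real"
  where "monomial a x = (\<Prod>i\<in>UNIV. (x $ i) ^ a i)"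

lemma polys_eq:
  "polys r = {p. \<exists>c. \<forall>x. p x = (\<Sum>a | sum a UNIV \<le> r. c a * monomial a x)}"
  by (simp add: polys_def monomial_def)

text \<open>Each exponent is at most the total degree. Finiteness matters because a sum over an
  infinite index set is 0 by default.\<close>

lemma finite_exponents: "finite {a :: 'n::finite \<Rightarrow> nat. sum a UNIV \<le> r}"
proof (rule finite_subset)
  show "{a :: 'n \<Rightarrow> nat. sum a UNIV \<le> r} \<subseteq> PiE UNIV (\<lambda>_. {..r})"
  proof
    fix a :: "'n \<Rightarrow> nat" assume "a \<in> {a. sum a UNIV \<le> r}"
    moreover have "a i \<le> sum a UNIV" for i by (rule member_le_sum) auto
    ultimately show "a \<in> PiE UNIV (\<lambda>_. {..r})" by (auto simp: PiE_UNIV_domain intro: order_trans)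
  qed
qed (auto intro: finite_PiE)

lemma polys_add:
  assumes "p \<in> polys r" "q \<in> polys r"
  shows "(\<lambda>x. p x + q x) \<in> polys r"
proof -
  obtain c d where p: "\<forall>x. p x = (\<Sum>a | sum a UNIV \<le> r. c a * monomial a x)"
    and q: "\<forall>x. q x = (\<Sum>a | sum a UNIV \<le> r. d a * monomial a x)"
    using assms unfolding polys_eq by blast
  have "p x + q x = (\<Sum>a | sum a UNIV \<le> r. (c a + d a) * monomial a x)" for x
    by (simp only: p q distrib_right sum.distrib)
  then show ?thesis
    unfolding polys_eq by (intro CollectI exI[of _ "\<lambda>a. c a + d a"] allI)
qed

lemma polys_cmult:
  assumes "p \<in> polys r"
  shows "(\<lambda>x. k * p x) \<in> polys r"
proof -
  obtain c where p: "\<forall>x. p x = (\<Sum>a | sum a UNIV \<le> r. c a * monomial a x)"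
    using assms unfolding polys_eq by blast
  have "k * p x = (\<Sum>a | sum a UNIV \<le> r. (k * c a) * monomial a x)" for x
    by (simp only: p sum_distrib_left mult.assoc)
  then show ?thesis
    unfolding polys_eq by (intro CollectI exI[of _ "\<lambda>a. k * c a"] allI)
qed

lemma polys_zero: "(\<lambda>x. 0) \<in> polys r"
  unfolding polys_eq by (intro CollectI exI[of _ "\<lambda>a. 0"] allI) simp

lemma polys_sum: "(\<And>i. i \<in> I \<Longrightarrow> p i \<in> polys r) \<Longrightarrow> (\<lambda>x. \<Sum>i\<in>I. p i x) \<in> polys r"
  by (induction I rule: infinite_finite_induct) (simp_all add: polys_zero polys_add)

lemma polys_monomial:
  fixes a :: "'n::finite \<Rightarrow> nat"
  assumes "sum a UNIV \<le> r"
  shows "monomial a \<in> polys r"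
proof -
  have "monomial a x = (\<Sum>b | sum b UNIV \<le> r. (if b = a then 1 else 0) * monomial b x)" for x
  proof -
    have "(\<Sum>b | sum b UNIV \<le> r. (if b = a then 1 else 0) * monomial b x) =
        (\<Sum>b | sum b UNIV \<le> r. if b = a then monomial b x else 0)"
      by (rule sum.cong) auto
    also have "\<dots> = monomial a x"
      using assms by (subst sum.delta) (auto simp: finite_exponents)
    finally show ?thesis by simp
  qed
  then show ?thesis
    unfolding polys_eq by (intro CollectI exI[of _ "\<lambda>b. if b = a then 1 else 0"] allI)
qed

lemma polys_continuous: "p \<in> polys r \<Longrightarrow> continuous_on UNIV p"
proof -
  assume "p \<in> polys r"
  then obtain c where "p = (\<lambda>x. \<Sum>a | sum a UNIV \<le> r. c a * monomial a x)"
    by (auto simp: polys_eq)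
  then show ?thesis by (simp add: monomial_def) (intro continuous_intros)
qed

text \<open>The power rule needs no case distinction: for \<open>a i = 0\<close> truncated
  subtraction leaves the exponent 0, but the factor \<open>real (a i)\<close> vanishes.\<close>

lemma gderiv_monomial:
  fixes a :: "'n::finite \<Rightarrow> nat"
  shows "GDERIV (monomial a) x :> (\<chi> i. real (a i) * monomial (a(i := a i - 1)) x)"
proof -
  have "monomial (a(i := a i - 1)) x = (x $ i) ^ (a i - 1) * (\<Prod>j\<in>UNIV - {i}. (x $ j) ^ a j)" for i
    unfolding monomial_def by (subst prod.remove[of UNIV i]) (auto intro!: prod.cong)
  moreover have "((\<lambda>x. \<Prod>i\<in>UNIV. (x $ i) ^ a i) has_derivative
      (\<lambda>h. \<Sum>i\<in>UNIV. (real (a i) * (h $ i) * (x $ i) ^ (a i - 1)) * (\<Prod>j\<in>UNIV - {i}. (x $ j) ^ a j))) (at x)"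
    by (intro has_derivative_prod has_derivative_power bounded_linear_imp_has_derivative bounded_linear_vec_nth)
  ultimately show ?thesis
    unfolding gderiv_def monomial_def[abs_def, symmetric]
    by (simp add: inner_vec_def mult_ac monomial_def[abs_def])
qed

text \<open>The first degree bound serves \<open>BDM\<close>, where r = s + 1, the second the part q
  x of an \<open>RT\<close> field. The second does not follow from the first at r = 0, where
  truncated subtraction leaves r - 1 = 0.\<close>

lemma polys_gderiv:
  fixes p :: "real^'n::finite \<Rightarrow> real"
  assumes "p \<in> polys r"
  obtains p' where "\<And>i. p' i \<in> polys (r - 1)" "\<And>i. (\<lambda>x. x $ i * p' i x) \<in> polys r"
    "\<And>x. GDERIV p x :> (\<chi> i. p' i x)"
proof -
  obtain c where p: "p = (\<lambda>x. \<Sum>a | sum a UNIV \<le> r. c a * monomial a x)"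
    using assms by (auto simp: polys_eq)
  define p' where
    "p' i x = (\<Sum>a | sum a UNIV \<le> r. c a * (real (a i) * monomial (a(i := a i - 1)) x))" for i x
  have deg: "sum (a(i := a i - 1)) UNIV = sum a UNIV - 1" if "a i > 0" for a :: "'n \<Rightarrow> nat" and i
  proof -
    have "sum a UNIV = a i + sum a (UNIV - {i})" by (simp add: sum.remove)
    moreover have "sum (a(i := a i - 1)) UNIV = (a i - 1) + sum a (UNIV - {i})"
      by (subst sum.remove[of UNIV i]) (auto intro!: sum.cong)
    ultimately show ?thesis using that by simp
  qed
  have "(\<lambda>x. real (a i) * monomial (a(i := a i - 1)) x) \<in> polys (r - 1)"
    if "sum a UNIV \<le> r" for a :: "'n \<Rightarrow> nat" and i
  proof (cases "a i = 0")
    case False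
    then show ?thesis using that deg[of a i] by (intro polys_cmult polys_monomial) auto
  qed (simp add: polys_zero)
  then have 1: "p' i \<in> polys (r - 1)" for i
    unfolding p'_def[abs_def] by (intro polys_sum polys_cmult[of "\<lambda>x. real (_ i) * monomial (_(i := _ i - 1)) x"]) simp
  \<comment> \<open>Monomials are eigenfunctions of x_i d/dx_i with eigenvalue \<open>a i\<close>,
    so this operator only rescales coefficients.\<close>
  have euler: "x $ i * (real (a i) * monomial (a(i := a i - 1)) x) = real (a i) * monomial a x"
    for a :: "'n \<Rightarrow> nat" and i and x
  proof (cases "a i = 0")
    case False
    then have "x $ i * (x $ i) ^ (a i - 1) = (x $ i) ^ a i" by (cases "a i") auto
    moreover have "monomial (a(i := a i - 1)) x = (x $ i) ^ (a i - 1) * (\<Prod>j\<in>UNIV - {i}. (x $ j) ^ a j)"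
      unfolding monomial_def by (subst prod.remove[of UNIV i]) (auto intro!: prod.cong)
    moreover have "monomial a x = (x $ i) ^ a i * (\<Prod>j\<in>UNIV - {i}. (x $ j) ^ a j)"
      unfolding monomial_def by (subst prod.remove[of UNIV i]) auto
    ultimately show ?thesis by (metis mult.assoc mult.left_commute)
  qed simp
  have "x $ i * p' i x = (\<Sum>a | sum a UNIV \<le> r. c a * (real (a i) * monomial a x))" for i x
    unfolding p'_def sum_distrib_left by (simp only: mult.left_commute[of "x $ i" "c _"] euler)
  moreover have "(\<lambda>x. \<Sum>a | sum a UNIV \<le> r. c a * (real (a i) * monomial a x)) \<in> polys r" for i
    by (intro polys_sum polys_cmult polys_monomial) auto
  ultimately have 2: "(\<lambda>x. x $ i * p' i x) \<in> polys r" for i by (simp only:)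
  have 3: "GDERIV p x :> (\<chi> i. p' i x)" for x
  proof -
    have "GDERIV p x :>
        (\<Sum>a | sum a UNIV \<le> r. c a *\<^sub>R (\<chi> i. real (a i) * monomial (a(i := a i - 1)) x))"
      unfolding p using GDERIV_mult[OF GDERIV_const gderiv_monomial] by (intro gderiv_sum) simp
    moreover have "(\<Sum>a | sum a UNIV \<le> r. c a *\<^sub>R (\<chi> i. real (a i) * monomial (a(i := a i - 1)) x)) =
        (\<chi> i. p' i x)"
      by (simp add: vec_eq_iff p'_def)
    ultimately show ?thesis by (simp only:)
  qed
  show ?thesis by (rule that[OF 1 2 3])
qed

lemma polys_mono:
  assumes "p \<in> polys r" "r \<le> s"
  shows "p \<in> polys s"
proof -
  obtain c where p: "p = (\<lambda>x. \<Sum>a | sum a UNIV \<le> r. c a * monomial a x)"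
    using assms(1) by (auto simp: polys_eq)
  show ?thesis
    unfolding p using assms(2) by (intro polys_sum polys_cmult polys_monomial) auto
qed

section \<open>The local divergence of Raviart-Thomas and Brezzi-Douglas-Marini fields\<close>

lemma sum_Basis_vec: "(\<Sum>b\<in>(Basis :: (real^'n::finite) set). f b) = (\<Sum>i\<in>UNIV. f (axis i 1))"
proof -
  have "sum f Basis = sum f (range (\<lambda>i. axis i 1))"
    by (rule arg_cong[where f = "sum f"]) (auto simp: Basis_vec_def)
  also have "\<dots> = (\<Sum>i\<in>UNIV. f (axis i 1))"
    by (subst sum.reindex) (auto simp: inj_on_def axis_eq_axis)
  finally show ?thesis .
qed

lemma has_derivative_vec_of_gderiv:
  fixes P :: "real^'n::finite \<Rightarrow> real^'m::finite"
  assumes "\<And>i. GDERIV (\<lambda>y. P y $ i) x :> G i"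
  shows "(P has_derivative (\<lambda>h. \<chi> i. h \<bullet> G i)) (at x)"
  unfolding has_derivative_componentwise_within[of P]
  using assms by (auto simp: Basis_vec_def inner_axis gderiv_def)

text \<open>The divergence of a field in \<open>P\<^sub>s\<^sup>n + x P\<^sub>s\<close> only has degree \<open>s\<close>, because multiplying
  \<open>\<partial>\<^sub>i q\<close> by \<open>x\<^sub>i\<close> does not raise the degree beyond that of \<open>q\<close>.\<close>

lemma RT_BDM_local_divergence:
  fixes u :: "real^'n::finite \<Rightarrow> real^'n"
  assumes u: "u \<in> RT \<Omega> T s \<union> BDM \<Omega> T (s + 1)" and K: "K \<in> T"
  obtains P P' where "\<forall>x\<in>interior K. u x = P x" "\<forall>x. (P has_derivative P' x) (at x)"
    "\<forall>b\<in>Basis. continuous_on UNIV (\<lambda>x. P' x b)"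
    "(\<lambda>x. \<Sum>b\<in>Basis. P' x b \<bullet> b) \<in> polys s"
proof -
  note result = that
  \<comment> \<open>Common to both spaces: \<open>d i j\<close> is the j-th partial derivative of
    the i-th component. Entries need only be continuous; the degree bound concerns the trace
    alone.\<close>
  have *: thesis if P: "\<And>x. x \<in> interior K \<Longrightarrow> u x = P x"
      and D: "\<And>i x. GDERIV (\<lambda>y. P y $ i) x :> (\<chi> j. d i j x)"
      and cont: "\<And>i j. continuous_on UNIV (d i j)"
      and trace: "(\<lambda>x. \<Sum>i\<in>UNIV. d i i x) \<in> polys s"
    for P and d :: "'n \<Rightarrow> 'n \<Rightarrow> real^'n \<Rightarrow> real"
  proof (rule result[of P "\<lambda>x h. \<chi> i. h \<bullet> (\<chi> j. d i j x)"])
    show "\<forall>x. (P has_derivative (\<lambda>h. \<chi> i. h \<bullet> (\<chi> j. d i j x))) (at x)"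
      by (intro allI has_derivative_vec_of_gderiv[OF D])
    show "\<forall>b\<in>Basis. continuous_on UNIV (\<lambda>x. \<chi> i. b \<bullet> (\<chi> j. d i j x))"
      by (intro ballI continuous_intros continuous_on_vec_lambda cont)
    show "(\<lambda>x. \<Sum>b\<in>Basis. (\<chi> i. b \<bullet> (\<chi> j. d i j x)) \<bullet> b) \<in> polys s"
      using trace by (simp add: sum_Basis_vec inner_axis inner_axis')
  qed (use P in blast)
  from u show thesis
  proof
    assume "u \<in> BDM \<Omega> T (s + 1)"
    then obtain p where p: "\<And>i. p i \<in> polys (s + 1)" "\<And>x. x \<in> interior K \<Longrightarrow> u x = (\<chi> i. p i x)"
      using K unfolding BDM_def by blast
    have "\<exists>p'. (\<forall>j. p' j \<in> polys s) \<and> (\<forall>x. GDERIV (p i) x :> (\<chi> j. p' j x))" for i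
      using polys_gderiv[OF p(1)[of i]] by (metis add_diff_cancel_right')
    then obtain d where d: "\<And>i j. d i j \<in> polys s" "\<And>i x. GDERIV (p i) x :> (\<chi> j. d i j x)"
      by metis
    show thesis
      by (rule *[of "\<lambda>x. \<chi> i. p i x" d])
        (use p(2) d in \<open>auto intro: polys_sum polys_continuous\<close>)
  next
    assume "u \<in> RT \<Omega> T s"
    then obtain p q where p: "\<And>i. p i \<in> polys s" and q: "q \<in> polys s"
      and eq: "\<And>x. x \<in> interior K \<Longrightarrow> u x = (\<chi> i. p i x) + q x *\<^sub>R x"
      using K unfolding RT_def by blast
    have "\<exists>p'. (\<forall>j. p' j \<in> polys s) \<and> (\<forall>x. GDERIV (p i) x :> (\<chi> j. p' j x))" for i
      using polys_gderiv[OF p[of i]] polys_mono[of _ "s - 1" s] by (metis diff_le_self)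
    then obtain d where d: "\<And>i j. d i j \<in> polys s" "\<And>i x. GDERIV (p i) x :> (\<chi> j. d i j x)"
      by metis
    obtain e where e: "\<And>j. e j \<in> polys (s - 1)" "\<And>j. (\<lambda>x. x $ j * e j x) \<in> polys s"
      "\<And>x. GDERIV q x :> (\<chi> j. e j x)"
      using polys_gderiv[OF q] by metis
    have coord: "GDERIV (\<lambda>x. x $ i) x :> axis i 1" for i and x :: "real^'n"
      unfolding gderiv_def
      by (simp add: inner_axis bounded_linear_imp_has_derivative bounded_linear_vec_nth)
    \<comment> \<open>The product rule for p_i + q x_i. On the diagonal it contributes q and x_i
      times the i-th partial derivative of q, both of degree at most s.\<close>
    define c where "c i j x = d i j x + (q x * (if i = j then 1 else 0) + x $ i * e j x)"
      for i j :: 'n and x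
    show thesis
    proof (rule *[of "\<lambda>x. (\<chi> i. p i x) + q x *\<^sub>R x" c])
      show "GDERIV (\<lambda>y. ((\<chi> i. p i y) + q y *\<^sub>R y) $ i) x :> (\<chi> j. c i j x)" for i x
      proof -
        have "GDERIV (\<lambda>y. p i y + q y * y $ i) x :>
            (\<chi> j. d i j x) + (q x *\<^sub>R axis i 1 + x $ i *\<^sub>R (\<chi> j. e j x))"
          by (intro GDERIV_add GDERIV_mult d e coord)
        moreover have "(\<chi> j. d i j x) + (q x *\<^sub>R axis i 1 + x $ i *\<^sub>R (\<chi> j. e j x)) = (\<chi> j. c i j x)"
          by (auto simp: vec_eq_iff c_def axis_def)
        ultimately show ?thesis by simp
      qed
      show "continuous_on UNIV (c i j)" for i j
        unfolding c_def[abs_def]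
        by (intro continuous_intros polys_continuous[OF d(1)] polys_continuous[OF q] polys_continuous[OF e(1)])
      show "(\<lambda>x. \<Sum>i\<in>UNIV. c i i x) \<in> polys s"
        unfolding c_def using d(1) q e(2) by (simp add: polys_sum polys_add)
    qed (rule eq)
  qed
qed

section \<open>The weak divergence as an element of the pressure space\<close>

lemma divergence_in_DG_AE:
  fixes u :: "real^'n::finite \<Rightarrow> real^'n"
  assumes \<Omega>: "open \<Omega>" "bounded \<Omega>"
    and T: "finite T" "\<And>K. K \<in> T \<Longrightarrow> interior K \<subseteq> \<Omega>"
    and u: "u \<in> RT \<Omega> T s \<union> BDM \<Omega> T (s + 1)"
  obtains q where "q \<in> DG \<Omega> T s" "AE x in lebesgue. x \<in> \<Omega> \<longrightarrow> divergence \<Omega> u x = q x"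
    "square_integrable \<Omega> (divergence \<Omega> u)"
proof -
  define d where "d = divergence \<Omega> u"
  have "\<exists>d. square_integrable \<Omega> d \<and> has_weak_div \<Omega> u d"
    using u by (auto simp: RT_def BDM_def H0_div_def)
  then have d: "square_integrable \<Omega> d" "has_weak_div \<Omega> u d"
    using someI_ex[of "\<lambda>d. square_integrable \<Omega> d \<and> has_weak_div \<Omega> u d"]
    unfolding d_def divergence_def by auto
  \<comment> \<open>One formula for the classical divergence on all elements avoids choosing a
    polynomial for each. Agreement of u with \<open>P\<close> on the open interior transfers the
    derivative.\<close>
  define t where "t x = (\<Sum>b\<in>Basis. frechet_derivative u (at x) b \<bullet> b)" for x
  have loc: "\<exists>D\<in>polys s. (\<forall>x\<in>interior K. t x = D x) \<and> (AE x in lebesgue. x \<in> interior K \<longrightarrow> d x = D x)"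
    if K: "K \<in> T" for K
  proof -
    obtain P P' where P: "\<forall>x\<in>interior K. u x = P x" "\<forall>x. (P has_derivative P' x) (at x)"
      "\<forall>b\<in>Basis. continuous_on UNIV (\<lambda>x. P' x b)"
      "(\<lambda>x. \<Sum>b\<in>Basis. P' x b \<bullet> b) \<in> polys s"
      by (rule RT_BDM_local_divergence[OF u K])
    have "t x = (\<Sum>b\<in>Basis. P' x b \<bullet> b)" if x: "x \<in> interior K" for x
    proof -
      have "(u has_derivative P' x) (at x)"
        by (rule has_derivative_transform_within_open[OF P(2)[rule_format] open_interior x])
          (simp add: P(1))
      from frechet_derivative_at[OF this] show ?thesis by (simp add: t_def)
    qed
    moreover have "AE x in lebesgue. x \<in> interior K \<longrightarrow> d x = (\<Sum>b\<in>Basis. P' x b \<bullet> b)"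
      by (rule weak_div_eq_classical_div[OF \<Omega> d open_interior T(2)[OF K] P(1-3)[rule_format]])
    ultimately show ?thesis by (intro bexI[OF _ P(4)] conjI ballI)
  qed
  \<comment> \<open>Points in no open element keep the value of d, so the two functions agree there
    by construction and exceptional null sets arise only inside elements.\<close>
  define q where "q x = (if \<exists>K\<in>T. x \<in> interior K then t x else d x)" for x
  have "AE x in lebesgue. \<forall>K\<in>T. x \<in> interior K \<longrightarrow> d x = t x"
  proof (rule AE_finite_allI[OF T(1)])
    fix K assume "K \<in> T"
    from loc[OF this] obtain D where D: "\<forall>x\<in>interior K. t x = D x"
      and ae: "AE x in lebesgue. x \<in> interior K \<longrightarrow> d x = D x"
      by auto
    from ae show "AE x in lebesgue. x \<in> interior K \<longrightarrow> d x = t x"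
      by eventually_elim (simp add: D)
  qed
  then have ae: "AE x in lebesgue. d x = q x"
    by eventually_elim (auto simp: q_def)
  then have ae\<Omega>: "AE x in lebesgue. x \<in> \<Omega> \<longrightarrow> d x = q x"
    by eventually_elim simp
  have dmeas: "d \<in> borel_measurable (lebesgue_on \<Omega>)"
    using d(1) by (simp add: square_integrable_def)
  have qmeas: "q \<in> borel_measurable (lebesgue_on \<Omega>)"
    by (rule borel_measurable_lebesgue_on_AE_eq[OF dmeas \<Omega>(1) ae\<Omega>])
  have ae': "AE x in lebesgue_on \<Omega>. d x = q x"
    using ae\<Omega> \<Omega>(1) by (simp add: AE_restrict_space_iff)
  have "integrable (lebesgue_on \<Omega>) (\<lambda>x. (norm (q x))\<^sup>2)"
  proof (rule Bochner_Integration.integrable_cong_AE_imp)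
    show "integrable (lebesgue_on \<Omega>) (\<lambda>x. (norm (d x))\<^sup>2)"
      using d(1) by (simp add: square_integrable_def)
    show "(\<lambda>x. (norm (q x))\<^sup>2) \<in> borel_measurable (lebesgue_on \<Omega>)"
      using qmeas by measurable
    show "AE x in lebesgue_on \<Omega>. (norm (d x))\<^sup>2 = (norm (q x))\<^sup>2"
      using ae' by eventually_elim simp
  qed
  then have "square_integrable \<Omega> q" using qmeas by (simp add: square_integrable_def)
  moreover have "\<exists>p\<in>polys s. \<forall>x\<in>interior K. q x = p x" if K: "K \<in> T" for K
  proof -
    obtain D where D: "D \<in> polys s" "\<forall>x\<in>interior K. t x = D x" using loc[OF K] by auto
    have "q x = D x" if "x \<in> interior K" for x
      using D(2) that K unfolding q_def by auto
    with D(1) show ?thesis by blast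
  qed
  ultimately have "q \<in> DG \<Omega> T s" by (simp add: DG_def)
  then show thesis using ae\<Omega> d(1) unfolding d_def by (rule that)
qed

text \<open>The orthogonality is tested with the corrected copy q, which is known to lie in
  \<open>DG\<close>. Equality almost everywhere turns the pairing into the squared norm of q, and
  the vanishing of q carries over to the divergence.\<close>

lemma divergence_AE_eq_0:
  fixes u :: "real^'n::finite \<Rightarrow> real^'n"
  assumes \<Omega>: "open \<Omega>" "bounded \<Omega>"
    and T: "finite T" "\<And>K. K \<in> T \<Longrightarrow> interior K \<subseteq> \<Omega>"
    and u: "u \<in> RT \<Omega> T s \<union> BDM \<Omega> T (s + 1)"
    and orth: "\<And>q. q \<in> DG \<Omega> T s \<Longrightarrow> L2_inner \<Omega> (divergence \<Omega> u) q = 0"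
  shows "AE x in lebesgue_on \<Omega>. divergence \<Omega> u x = 0"
proof -
  obtain q where q: "q \<in> DG \<Omega> T s" "AE x in lebesgue. x \<in> \<Omega> \<longrightarrow> divergence \<Omega> u x = q x"
    and d: "square_integrable \<Omega> (divergence \<Omega> u)"
    using divergence_in_DG_AE[OF \<Omega> T u] by metis
  have ae: "AE x in lebesgue_on \<Omega>. divergence \<Omega> u x = q x"
    using q(2) \<Omega>(1) by (simp add: AE_restrict_space_iff)
  have [measurable]: "q \<in> borel_measurable (lebesgue_on \<Omega>)"
    "divergence \<Omega> u \<in> borel_measurable (lebesgue_on \<Omega>)"
    using q(1) d by (auto simp: DG_def square_integrable_def)
  have int: "integrable (lebesgue_on \<Omega>) (\<lambda>x. (q x)\<^sup>2)"
    using q(1) by (simp add: DG_def square_integrable_def)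
  have "0 = (LINT x|lebesgue_on \<Omega>. divergence \<Omega> u x * q x)"
    using orth[OF q(1)] by (simp add: L2_inner_def)
  also have "\<dots> = (LINT x|lebesgue_on \<Omega>. (q x)\<^sup>2)"
    by (rule integral_cong_AE) (use ae in \<open>auto simp: power2_eq_square\<close>)
  finally have "AE x in lebesgue_on \<Omega>. (q x)\<^sup>2 = 0"
    using integral_nonneg_eq_0_iff_AE[OF int] by simp
  with ae show ?thesis by eventually_elim simp
qed

theorem proposition3p1:
  fixes \<Omega> :: "('n::{finite,comm_ring_1}) rvec set"
    and T :: "'n rvec set set"
    and \<nu> :: "'n rvec set \<Rightarrow> 'n rvec"
    and s m :: nat
    and U :: "('n rvec \<Rightarrow> 'n rvec) set"
    and F Q :: "('n rvec \<Rightarrow> real) set"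
    and \<alpha> \<beta> :: "'n rvec set \<Rightarrow> ('n rvec \<Rightarrow> 'n rvec) \<Rightarrow> 'n rvec \<Rightarrow> real"
    and \<Delta>t :: real
    and u :: "nat \<Rightarrow> 'n rvec \<Rightarrow> 'n rvec"
    and \<rho> p :: "nat \<Rightarrow> 'n rvec \<Rightarrow> real"
  defines "E \<equiv> interior_faces \<Omega> T"
    and "\<rho>u \<equiv> (\<lambda>k x. \<rho> k x *\<^sub>R u k x)"
    and "uu \<equiv> (\<lambda>k. L2_proj \<Omega> F (\<lambda>x. u k x \<bullet> u (Suc k) x))"
  assumes dim: "CARD('n) = 2 \<or> CARD('n) = 3"
    and domain: "open \<Omega>" "connected \<Omega>" "\<Omega> \<noteq> {}" "bounded \<Omega>"
    and mesh: "mesh_of \<Omega> T"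
    and normals: "\<forall>e\<in>E. unit_normal e (\<nu> e)"
    and U: "U = RT \<Omega> T s \<or> U = BDM \<Omega> T (s + 1)"
    and F: "F = DG \<Omega> T m"
    and Q: "Q = DG \<Omega> T s"
    and alpha: "\<forall>e\<in>E. \<forall>w\<in>U. (\<forall>x\<in>e. \<alpha> e w x \<ge> 0) \<or>
      (\<exists>c1\<in>{0..1/2}. \<forall>x\<in>e. \<alpha> e w x =
        c1 * (normal_comp T (\<nu> e) e w x / \<bar>normal_comp T (\<nu> e) e w x\<bar>))"
    and beta: "\<forall>e\<in>E. \<forall>w\<in>U. \<forall>x\<in>e. \<beta> e w x \<ge> 0"
    and beta_zero: "\<forall>e\<in>E. \<forall>w\<in>U. \<forall>x\<in>e. normal_comp T (\<nu> e) e w x = 0 \<longrightarrow> \<beta> e w x = 0"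
    and well_defined:
      "\<forall>k. \<forall>v\<in>U. \<forall>e\<in>E. face_integrable (\<nu> e) e
        (momentum_alpha_term T (\<nu> e) e (\<alpha> e (half_step u k)) (half_step \<rho>u k) (half_step u k) v)"
      "\<forall>k. \<forall>v\<in>U. \<forall>e\<in>E. face_integrable (\<nu> e) e
        (momentum_beta_term T (\<nu> e) e (\<beta> e (half_step u k)) (half_step u k) v
          (uu k) (half_step \<rho> k))"
      "\<forall>k. \<forall>\<sigma>\<in>F. \<forall>e\<in>E. face_integrable (\<nu> e) e
        (density_beta_term T (\<nu> e) e (\<beta> e (half_step u k)) \<sigma> (half_step \<rho> k))"
    and time_step: "\<Delta>t > 0"
    and initial: "u 0 \<in> U" "AE x in lebesgue_on \<Omega>. divergence \<Omega> (u 0) x = 0" "\<rho> 0 \<in> F"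
    and iterates: "\<forall>k. u (Suc k) \<in> U" "\<forall>k. \<rho> (Suc k) \<in> F" "\<forall>k. p (Suc k) \<in> Q"
    and momentum: "\<forall>k. \<forall>v\<in>U.
      (\<Sum>e\<in>E. face_integral (\<nu> e) e
        (momentum_alpha_term T (\<nu> e) e (\<alpha> e (half_step u k)) (half_step \<rho>u k) (half_step u k) v)) +
      (\<Sum>e\<in>E. face_integral (\<nu> e) e
        (momentum_beta_term T (\<nu> e) e (\<beta> e (half_step u k)) (half_step u k) v
          (uu k) (half_step \<rho> k))) +
      L2_inner \<Omega> (\<lambda>x. (\<rho> (Suc k) x *\<^sub>R u (Suc k) x - \<rho> k x *\<^sub>R u k x) /\<^sub>R \<Delta>t) v +
      a_form \<Omega> T \<nu> (half_step \<rho>u k) (half_step u k) v -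
      1/2 * b_form \<Omega> T \<nu> v (uu k) (half_step \<rho> k) -
      L2_inner \<Omega> (p (Suc k)) (divergence \<Omega> v) = 0"
    and density: "\<forall>k. \<forall>\<sigma>\<in>F.
      L2_inner \<Omega> (\<lambda>x. (\<rho> (Suc k) x - \<rho> k x) / \<Delta>t) \<sigma> -
      b_form \<Omega> T \<nu> (half_step u k) \<sigma> (half_step \<rho> k) +
      (\<Sum>e\<in>E. face_integral (\<nu> e) e
        (density_beta_term T (\<nu> e) e (\<beta> e (half_step u k)) \<sigma> (half_step \<rho> k))) = 0"
    and incompressibility: "\<forall>k. \<forall>q\<in>Q. L2_inner \<Omega> (divergence \<Omega> (u (Suc k))) q = 0"
  shows "\<forall>k. AE x in lebesgue_on \<Omega>. divergence \<Omega> (u k) x = 0"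
proof
  fix k
  show "AE x in lebesgue_on \<Omega>. divergence \<Omega> (u k) x = 0"
  \<comment> \<open>A case distinction suffices instead of an induction over time, since each
    constraint involves the velocity at a single time level.\<close>
  proof (cases k)
    case 0
    then show ?thesis using initial(2) by simp
  next
    case (Suc j)
    have "u (Suc j) \<in> RT \<Omega> T s \<union> BDM \<Omega> T (s + 1)"
      using iterates(1) U by auto
    moreover have "finite T" "\<And>K. K \<in> T \<Longrightarrow> interior K \<subseteq> \<Omega>"
      using mesh by (auto simp: mesh_of_def triangulation_def)
    moreover have "L2_inner \<Omega> (divergence \<Omega> (u (Suc j))) q = 0" if "q \<in> DG \<Omega> T s" for q
      using incompressibility Q that by blast
    ultimately show ?thesis
      unfolding Suc by (intro divergence_AE_eq_0[OF domain(1,4)])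
  qed
qed


end
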